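(* There is an absolute constant $c>0$ such that for every $d\in\mathbb{N}$ the hypercube $Q_d$ is $\frac{c\,2^d}{d}$-minor-universal. Moreover, there is an absolute constant $C>0$ such that for every $d\in\mathbb{N}$ the hypercube $Q_d$ is not $\frac{C\,2^d}{\sqrt{d}}$-minor-universal.
   Context: All graphs are finite and simple. A graph $H$ is a minor of a graph $G$ ($H\le G$) if a graph isomorphic to $H$ can be obtained from $G$ by repeatedly deleting vertices, deleting edges and contracting edges. For a real number $m$, a graph $G$ is $m$-minor-universal if every graph with at most $m$ edges and with no isolated vertices is a minor of $G$. The $d$-dimensional hypercube $Q_d$ has vertex set $\{0,1\}^d$, two binary strings being adjacent iff they differ in exactly one coordinate. The first assertion is the paper's statement "$Q_d$ is $\Omega(2^d/d)$-minor-universal". *)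

theory Defs
  imports Complex_Main
begin

record 'a ugraph =
  verts :: "'a set"
  edges :: "'a set set"

definition simple_graph :: "'a ugraph \<Rightarrow> bool" where
  "simple_graph G \<longleftrightarrow> finite (verts G) \<and> (\<forall>e\<in>edges G. e \<subseteq> verts G \<and> card e = 2)"

definition no_isolated_vertices :: "'a ugraph \<Rightarrow> bool" where
  "no_isolated_vertices G \<longleftrightarrow> (\<forall>v\<in>verts G. \<exists>e\<in>edges G. v \<in> e)"

definition graph_isomorphic :: "'a ugraph \<Rightarrow> 'b ugraph \<Rightarrow> bool" where
  "graph_isomorphic G H \<longleftrightarrow>
     (\<exists>f. bij_betw f (verts G) (verts H) \<and>
          (\<forall>u\<in>verts G. \<forall>v\<in>verts G. {u, v} \<in> edges G \<longleftrightarrow> {f u, f v} \<in> edges H))"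

definition delete_vertex :: "'a ugraph \<Rightarrow> 'a \<Rightarrow> 'a ugraph" where
  "delete_vertex G v = \<lparr>verts = verts G - {v}, edges = {e \<in> edges G. v \<notin> e}\<rparr>"

definition delete_edge :: "'a ugraph \<Rightarrow> 'a set \<Rightarrow> 'a ugraph" where
  "delete_edge G e = \<lparr>verts = verts G, edges = edges G - {e}\<rparr>"

text \<open>Contraction of the edge \<open>{u, v}\<close>: the merged vertex keeps the name \<open>u\<close>. The edge itself,
  which would become a loop, is dropped; parallel edges coincide because edges form a set.\<close>

definition contract_edge :: "'a ugraph \<Rightarrow> 'a \<Rightarrow> 'a \<Rightarrow> 'a ugraph" where
  "contract_edge G u v =
     \<lparr>verts = verts G - {v},
      edges = (\<lambda>e. (\<lambda>w. if w = v then u else w) ` e) ` (edges G - {{u, v}})\<rparr>"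

inductive minor_step :: "'a ugraph \<Rightarrow> 'a ugraph \<Rightarrow> bool" where
  delete_vertex: "v \<in> verts G \<Longrightarrow> minor_step G (delete_vertex G v)"
| delete_edge: "e \<in> edges G \<Longrightarrow> minor_step G (delete_edge G e)"
| contract_edge: "{u, v} \<in> edges G \<Longrightarrow> u \<noteq> v \<Longrightarrow> minor_step G (contract_edge G u v)"

definition is_minor :: "'a ugraph \<Rightarrow> 'b ugraph \<Rightarrow> bool" where
  "is_minor H G \<longleftrightarrow> (\<exists>G'. minor_step\<^sup>*\<^sup>* G G' \<and> graph_isomorphic H G')"

text \<open>The graphs \<open>H\<close> range over a fixed infinite vertex type. This loses no generality, see
  \<open>minor_universalD\<close> below.\<close>

definition minor_universal :: "real \<Rightarrow> 'a ugraph \<Rightarrow> bool" where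
  "minor_universal m G \<longleftrightarrow>
     (\<forall>H :: nat ugraph. simple_graph H \<and> no_isolated_vertices H \<and> real (card (edges H)) \<le> m
        \<longrightarrow> is_minor H G)"

definition hypercube :: "nat \<Rightarrow> bool list ugraph" where
  "hypercube d =
     \<lparr>verts = {x. length x = d},
      edges = {{x, y} | x y. length x = d \<and> length y = d \<and> card {i. i < d \<and> x ! i \<noteq> y ! i} = 1}\<rparr>"

lemma simple_graph_hypercube: "simple_graph (hypercube d)"
proof -
  have "finite {x :: bool list. length x = d}"
    using finite_lists_length_eq[of "UNIV :: bool set" d] by simp
  moreover have "card {x, y} = 2"
    if "card {i. i < d \<and> x ! i \<noteq> y ! i} = 1" for x y :: "bool list"
    using that by (cases "x = y") auto
  ultimately show ?thesis
    by (auto simp: simple_graph_def hypercube_def)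
qed

lemma simple_graph_minor_step:
  assumes "minor_step G G'" "simple_graph G"
  shows "simple_graph G'"
  using assms
proof (induction rule: minor_step.induct)
  case (contract_edge u v G)
  let ?f = "\<lambda>w. if w = v then u else w"
  have *: "?f ` e \<subseteq> verts G - {v} \<and> card (?f ` e) = 2" if "e \<in> edges G" "e \<noteq> {u, v}" for e
  proof -
    have uv: "u \<in> verts G" and e: "e \<subseteq> verts G" "card e = 2"
      using contract_edge that by (auto simp: simple_graph_def)
    obtain a b where ab: "e = {a, b}" "a \<noteq> b"
      using e by (auto simp: card_2_iff)
    have "?f a \<noteq> ?f b"
      using ab that by (auto split: if_splits)
    then have "card (?f ` e) = 2"
      by (simp only: ab image_insert image_empty card_2_iff) blast
    then show ?thesis
      using uv e contract_edge.hyps by auto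
  qed
  then show ?case
    using contract_edge.prems unfolding simple_graph_def contract_edge_def
    by (simp del: image_subset_iff)
qed (auto simp: simple_graph_def delete_vertex_def delete_edge_def)

lemma minor_universalD:
  fixes H :: "'b ugraph"
  assumes "minor_universal m G" "simple_graph H" "no_isolated_vertices H"
    and "real (card (edges H)) \<le> m"
  shows "is_minor H G"
proof -
  have fin: "finite (verts H)" and E: "\<And>e. e \<in> edges H \<Longrightarrow> e \<subseteq> verts H \<and> card e = 2"
    using assms(2) by (auto simp: simple_graph_def)
  obtain f :: "'b \<Rightarrow> nat" where f: "inj_on f (verts H)"
    using finite_imp_inj_to_nat_seg[OF fin] by blast
  define K where "K = \<lparr>verts = f ` verts H, edges = (image f) ` edges H\<rparr>"
  have inj: "inj_on (image f) (edges H)"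
    by (rule inj_on_subset[OF inj_on_image_Pow[OF f]]) (use E in auto)
  have card: "card (f ` e) = 2" if "e \<in> edges H" for e
    using E[OF that] f by (metis card_image inj_on_subset)
  have "simple_graph K"
    using fin E card unfolding simple_graph_def K_def by auto
  moreover have "no_isolated_vertices K"
    using assms(3) by (fastforce simp: no_isolated_vertices_def K_def)
  moreover have "real (card (edges K)) \<le> m"
    using assms(4) by (simp add: K_def card_image[OF inj])
  ultimately have "is_minor K G"
    using assms(1) by (auto simp: minor_universal_def)
  then obtain G' g where G': "minor_step\<^sup>*\<^sup>* G G'" and g: "bij_betw g (verts K) (verts G')"
    and gE: "\<And>u v. u \<in> verts K \<Longrightarrow> v \<in> verts K \<Longrightarrow> {u, v} \<in> edges K \<longleftrightarrow> {g u, g v} \<in> edges G'"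
    by (auto simp: is_minor_def graph_isomorphic_def)
  have fb: "bij_betw f (verts H) (verts K)"
    using f by (simp add: bij_betw_def K_def)
  have fE: "{u, v} \<in> edges H \<longleftrightarrow> {f u, f v} \<in> edges K" if "u \<in> verts H" "v \<in> verts H" for u v
  proof
    assume "{f u, f v} \<in> edges K"
    then obtain e where e: "e \<in> edges H" "f ` e = f ` {u, v}"
      by (auto simp: K_def)
    then have "e = {u, v}"
      using inj_on_image_eq_iff[OF f, of e "{u, v}"] E that by auto
    with e show "{u, v} \<in> edges H" by simp
  next
    assume "{u, v} \<in> edges H"
    then have "f ` {u, v} \<in> edges K" unfolding K_def ugraph.simps by (rule imageI)
    then show "{f u, f v} \<in> edges K" by simp
  qed
  have "bij_betw (g \<circ> f) (verts H) (verts G')"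
    using fb g by (rule bij_betw_trans)
  moreover have "{u, v} \<in> edges H \<longleftrightarrow> {(g \<circ> f) u, (g \<circ> f) v} \<in> edges G'"
    if "u \<in> verts H" "v \<in> verts H" for u v
    using fE[OF that] gE[of "f u" "f v"] that by (auto simp: K_def)
  ultimately have "graph_isomorphic H G'"
    unfolding graph_isomorphic_def by blast
  with G' show ?thesis
    by (auto simp: is_minor_def)
qed

end

theory Submission
  imports Defs
begin

text \<open>
  Lower bound. Write \<open>d = k + 2 + l\<close> with \<open>2 ^ l\<close> between \<open>2 * d\<close> and \<open>4 * d\<close>, and view \<open>Q_d\<close> as
  \<open>Q_k \<times> Q_2 \<times> Q_l\<close>, where \<open>Q_l\<close> contains a Hamiltonian path of at least \<open>2 * k\<close> columns (Gray code).
  By the rearrangeability of the Benes network, every permutation of the vertices of \<open>Q_k\<close> is realised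
  by moving tokens simultaneously in \<open>2 * k\<close> rounds, each token staying put or crossing one edge; the
  factor \<open>Q_2\<close> makes the resulting walks vertex-disjoint. Place the half-edges of \<open>H\<close> along a
  Hamiltonian path of \<open>Q_k\<close>, so that those at a common vertex form an interval, and route the two halves
  of every edge to neighbouring positions: the union of the walks starting in an interval is a branch set.

  Upper bound. Assign to every branch set of a minor of \<open>Q_d\<close> the interval of Hamming weights that
  it meets. Every weight is met by at most \<open>s = d choose (d div 2)\<close> branch sets, so the sets meeting a
  suitable weight separate a minor with \<open>4 * s\<close> vertices into two parts with at least \<open>s\<close> vertices
  each. Counting shows that some graph with \<open>4 * s\<close> vertices and \<open>O(s)\<close> edges has no such separation,
  and \<open>s = O(2 ^ d / sqrt d)\<close>.
\<close>

section \<open>Layerings and minors\<close>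

text \<open>The interval from \<open>lo v\<close> to \<open>hi v\<close> stands for the layers met by the branch set of \<open>v\<close>. Intervals of
  adjacent vertices overlap or are consecutive, so that contracting an edge takes the union of two
  intervals without adding a layer.\<close>

definition layered :: "nat \<Rightarrow> 'a ugraph \<Rightarrow> bool" where
  "layered s G \<longleftrightarrow> (\<exists>lo hi :: 'a \<Rightarrow> nat.
     (\<forall>v\<in>verts G. lo v \<le> hi v) \<and>
     (\<forall>u\<in>verts G. \<forall>v\<in>verts G. {u, v} \<in> edges G \<longrightarrow> lo u \<le> hi v + 1) \<and>
     (\<forall>i. card {v \<in> verts G. lo v \<le> i \<and> i \<le> hi v} \<le> s))"

lemma layeredI:
  fixes lo hi :: "'a \<Rightarrow> nat"
  assumes "\<And>v. v \<in> verts G \<Longrightarrow> lo v \<le> hi v"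
    "\<And>u v. u \<in> verts G \<Longrightarrow> v \<in> verts G \<Longrightarrow> {u, v} \<in> edges G \<Longrightarrow> lo u \<le> hi v + 1"
    "\<And>i. card {v \<in> verts G. lo v \<le> i \<and> i \<le> hi v} \<le> s"
  shows "layered s G"
  unfolding layered_def by (rule exI[of _ lo], rule exI[of _ hi]) (use assms in auto)

lemma layeredE:
  assumes "layered s G" "simple_graph G"
  obtains lo hi :: "'a \<Rightarrow> nat" where
    "\<And>v. v \<in> verts G \<Longrightarrow> lo v \<le> hi v"
    "\<And>u v. u \<in> verts G \<Longrightarrow> v \<in> verts G \<Longrightarrow> {u, v} \<in> edges G \<Longrightarrow> lo u \<le> hi v + 1"
    "\<And>i. card {v \<in> verts G. lo v \<le> i \<and> i \<le> hi v} \<le> s"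
    "finite (verts G)" "\<And>e. e \<in> edges G \<Longrightarrow> e \<subseteq> verts G \<and> card e = 2"
proof -
  from assms(1) obtain lo hi :: "'a \<Rightarrow> nat" where
    "\<forall>v\<in>verts G. lo v \<le> hi v"
    "\<forall>u\<in>verts G. \<forall>v\<in>verts G. {u, v} \<in> edges G \<longrightarrow> lo u \<le> hi v + 1"
    "\<forall>i. card {v \<in> verts G. lo v \<le> i \<and> i \<le> hi v} \<le> s"
    unfolding layered_def by (elim exE conjE) (rule that)
  with assms(2) show thesis
    unfolding simple_graph_def by (intro that[of lo hi]) simp_all
qed

lemma layered_minor_step:
  assumes "minor_step G G'" "simple_graph G" "layered s G"
  shows "layered s G'"
  using assms
proof (induction rule: minor_step.induct)
  case (delete_vertex v G)
  from delete_vertex.prems(2,1) obtain lo hi :: "'a \<Rightarrow> nat" where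
    L: "\<And>v. v \<in> verts G \<Longrightarrow> lo v \<le> hi v"
       "\<And>u v. u \<in> verts G \<Longrightarrow> v \<in> verts G \<Longrightarrow> {u, v} \<in> edges G \<Longrightarrow> lo u \<le> hi v + 1"
       "\<And>i. card {v \<in> verts G. lo v \<le> i \<and> i \<le> hi v} \<le> s" and fin: "finite (verts G)"
    and E: "\<And>e. e \<in> edges G \<Longrightarrow> e \<subseteq> verts G \<and> card e = 2"
    by (rule layeredE) (rule that)
  have "card {u \<in> verts (delete_vertex G v). lo u \<le> i \<and> i \<le> hi u} \<le> s" for i
    by (rule order_trans[OF card_mono L(3)[of i]]) (use fin in \<open>auto simp: delete_vertex_def\<close>)
  then show ?case
    by (rule layeredI[of _ lo hi, rotated 2]) (use L in \<open>auto simp: delete_vertex_def\<close>)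
next
  case (delete_edge e G)
  from delete_edge.prems(2,1) obtain lo hi :: "'a \<Rightarrow> nat" where
    L: "\<And>v. v \<in> verts G \<Longrightarrow> lo v \<le> hi v"
       "\<And>u v. u \<in> verts G \<Longrightarrow> v \<in> verts G \<Longrightarrow> {u, v} \<in> edges G \<Longrightarrow> lo u \<le> hi v + 1"
       "\<And>i. card {v \<in> verts G. lo v \<le> i \<and> i \<le> hi v} \<le> s" and fin: "finite (verts G)"
    and E: "\<And>e. e \<in> edges G \<Longrightarrow> e \<subseteq> verts G \<and> card e = 2"
    by (rule layeredE) (rule that)
  show ?case
    by (rule layeredI[of _ lo hi]) (use L in \<open>auto simp: delete_edge_def\<close>)
next
  case (contract_edge a b G)
  from contract_edge.prems(2,1) obtain lo hi :: "'a \<Rightarrow> nat" where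
    L: "\<And>v. v \<in> verts G \<Longrightarrow> lo v \<le> hi v"
       "\<And>u v. u \<in> verts G \<Longrightarrow> v \<in> verts G \<Longrightarrow> {u, v} \<in> edges G \<Longrightarrow> lo u \<le> hi v + 1"
       "\<And>i. card {v \<in> verts G. lo v \<le> i \<and> i \<le> hi v} \<le> s" and fin: "finite (verts G)"
    and E: "\<And>e. e \<in> edges G \<Longrightarrow> e \<subseteq> verts G \<and> card e = 2"
    by (rule layeredE) (rule that)
  have ab: "a \<in> verts G" "b \<in> verts G" "{a, b} \<in> edges G" "{b, a} \<in> edges G" "a \<noteq> b"
    using contract_edge.hyps E[of "{a, b}"] by (auto simp: insert_commute)
  define lo' where "lo' = lo(a := min (lo a) (lo b))"
  define hi' where "hi' = hi(a := max (hi a) (hi b))"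
  define f where "f = (\<lambda>w. if w = b then a else w)"
  have le: "lo' (f v) \<le> lo v" "hi v \<le> hi' (f v)" for v
    by (auto simp: lo'_def hi'_def f_def)
  have 1: "lo' v \<le> hi' v" if "v \<in> verts G" for v
    using L(1)[OF that] by (auto simp: lo'_def hi'_def)
  have 2: "lo' u \<le> hi' v + 1" if uv: "{u, v} \<in> edges (contract_edge G a b)" for u v
  proof -
    obtain e where e: "e \<in> edges G" "{u, v} = f ` e"
      using uv by (auto simp: contract_edge_def f_def)
    then obtain x y where xy: "e = {x, y}" "x \<in> verts G" "y \<in> verts G"
      using E[OF e(1)] by (auto simp: card_2_iff)
    have "lo x \<le> hi y + 1" "lo y \<le> hi x + 1"
      using L(2)[of x y] L(2)[of y x] xy e by (auto simp: insert_commute)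
    moreover have "u = f x \<and> v = f y \<or> u = f y \<and> v = f x"
      using e xy by (auto simp: doubleton_eq_iff)
    ultimately show ?thesis
      using le[of x] le[of y] by auto
  qed
  have 3: "card {v \<in> verts G - {b}. lo' v \<le> i \<and> i \<le> hi' v} \<le> s" for i
  proof -
    have t: "lo a \<le> hi b + 1" "lo b \<le> hi a + 1"
      using L(2) ab by auto
    \<comment> \<open>Each vertex now meeting layer \<open>i\<close> is the image of one that met it
      before; for \<open>a\<close> this holds because the hull of two overlapping or consecutive
      intervals is their union.\<close>
    have "{v \<in> verts G - {b}. lo' v \<le> i \<and> i \<le> hi' v}
            \<subseteq> f ` {v \<in> verts G. lo v \<le> i \<and> i \<le> hi v}"
    proof
      fix v assume v: "v \<in> {v \<in> verts G - {b}. lo' v \<le> i \<and> i \<le> hi' v}"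
      show "v \<in> f ` {v \<in> verts G. lo v \<le> i \<and> i \<le> hi v}"
      proof (cases "v = a")
        case True
        then have "lo a \<le> i \<and> i \<le> hi a \<or> lo b \<le> i \<and> i \<le> hi b"
          using v t by (auto simp: lo'_def hi'_def)
        then show ?thesis
          using True ab by (auto simp: f_def image_iff)
      next
        case False
        with v have "v = f v" "v \<in> {v \<in> verts G. lo v \<le> i \<and> i \<le> hi v}"
          by (auto simp: lo'_def hi'_def f_def)
        then show ?thesis by blast
      qed
    qed
    then have "card {v \<in> verts G - {b}. lo' v \<le> i \<and> i \<le> hi' v}
            \<le> card {v \<in> verts G. lo v \<le> i \<and> i \<le> hi v}"
      using fin by (intro surj_card_le) auto
    then show ?thesis using L(3)[of i] by simp
  qed
  show ?case
  proof (rule layeredI[of _ lo' hi'])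
    show "card {v \<in> verts (contract_edge G a b). lo' v \<le> i \<and> i \<le> hi' v} \<le> s" for i
      using 3[of i] by (simp add: contract_edge_def)
  qed (use 1 2 in \<open>auto simp: contract_edge_def\<close>)
qed

lemma layered_minor:
  assumes "is_minor H G" "simple_graph G" "layered s G"
  shows "layered s H"
proof -
  obtain G' where st: "minor_step\<^sup>*\<^sup>* G G'" and iso: "graph_isomorphic H G'"
    using assms(1) by (auto simp: is_minor_def)
  from st have "layered s G' \<and> simple_graph G'"
    by induction (use assms layered_minor_step simple_graph_minor_step in blast)+
  then have "layered s G'" "simple_graph G'" by auto
  then obtain lo hi :: "_ \<Rightarrow> nat" where
    L: "\<And>v. v \<in> verts G' \<Longrightarrow> lo v \<le> hi v"
       "\<And>u v. u \<in> verts G' \<Longrightarrow> v \<in> verts G' \<Longrightarrow> {u, v} \<in> edges G' \<Longrightarrow> lo u \<le> hi v + 1"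
       "\<And>i. card {v \<in> verts G'. lo v \<le> i \<and> i \<le> hi v} \<le> s" and fin: "finite (verts G')"
    and E: "\<And>e. e \<in> edges G' \<Longrightarrow> e \<subseteq> verts G' \<and> card e = 2"
    by (rule layeredE) (rule that)
  obtain f where f: "bij_betw f (verts H) (verts G')"
    and fE: "\<And>u v. u \<in> verts H \<Longrightarrow> v \<in> verts H \<Longrightarrow> {u, v} \<in> edges H \<longleftrightarrow> {f u, f v} \<in> edges G'"
    using iso by (auto simp: graph_isomorphic_def)
  have fv: "f v \<in> verts G'" if "v \<in> verts H" for v
    using f that by (auto simp: bij_betw_def)
  have "card {v \<in> verts H. lo (f v) \<le> i \<and> i \<le> hi (f v)} \<le> s" for i
  proof -
    have "inj_on f {v \<in> verts H. lo (f v) \<le> i \<and> i \<le> hi (f v)}"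
      using f by (auto simp: bij_betw_def inj_on_def)
    then have "card {v \<in> verts H. lo (f v) \<le> i \<and> i \<le> hi (f v)}
        \<le> card {v \<in> verts G'. lo v \<le> i \<and> i \<le> hi v}"
      by (rule card_inj_on_le) (use fin fv in auto)
    with L(3)[of i] show ?thesis by simp
  qed
  then show ?thesis
    by (rule layeredI[of _ "\<lambda>v. lo (f v)" "\<lambda>v. hi (f v)", rotated 2]) (use L(1,2) fv fE in auto)
qed

section \<open>Balanced separators, and graphs that have none\<close>

text \<open>Cut at a layer \<open>i\<close> where the number of intervals that have ended passes
  \<open>2 * s\<close>. At most \<open>2 * s\<close> intervals end before \<open>i\<close>, at most
  \<open>s\<close> contain \<open>i\<close>, and at most \<open>2 * s\<close> begin after it, since
  more than \<open>2 * s\<close> of all \<open>4 * s\<close> have ended by then. Hence each outer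
  part keeps at least \<open>s\<close> vertices.\<close>

lemma layered_separator:
  assumes "layered s G" "simple_graph G" and n: "card (verts G) = 4 * s" and s: "s > 0"
  obtains A B where "A \<subseteq> verts G" "B \<subseteq> verts G" "A \<inter> B = {}" "card A \<ge> s" "card B \<ge> s"
    "\<And>a b. a \<in> A \<Longrightarrow> b \<in> B \<Longrightarrow> {a, b} \<notin> edges G"
proof -
  from assms(1,2) obtain lo hi :: "_ \<Rightarrow> nat" where
    L: "\<And>v. v \<in> verts G \<Longrightarrow> lo v \<le> hi v"
       "\<And>u v. u \<in> verts G \<Longrightarrow> v \<in> verts G \<Longrightarrow> {u, v} \<in> edges G \<Longrightarrow> lo u \<le> hi v + 1"
       "\<And>i. card {v \<in> verts G. lo v \<le> i \<and> i \<le> hi v} \<le> s" and fin: "finite (verts G)"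
    and E: "\<And>e. e \<in> edges G \<Longrightarrow> e \<subseteq> verts G \<and> card e = 2"
    by (rule layeredE) (rule that)
  define P where "P = (\<lambda>i. card {v \<in> verts G. hi v < i} > 2 * s)"
  have "{v \<in> verts G. hi v < Suc (Max (hi ` verts G))} = verts G"
    using fin by (auto simp: less_Suc_eq_le)
  then have "P (Suc (Max (hi ` verts G)))"
    using n s by (simp add: P_def)
  moreover have "\<not> P 0" by (simp add: P_def)
  ultimately obtain i where i: "\<not> P i" "P (Suc i)"
    using nat_induct[of "\<lambda>i. \<not> P i"] by blast
  let ?A = "{v \<in> verts G. hi v < i}" and ?B = "{v \<in> verts G. i < lo v}"
  let ?M = "{v \<in> verts G. lo v \<le> i \<and> i \<le> hi v}" and ?C = "{v \<in> verts G. hi v < Suc i}"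
  have "card (?A \<union> ?M \<union> ?B) \<le> card ?A + card ?M + card ?B"
    by (meson add_le_mono1 card_Un_le order_trans)
  moreover have "?A \<union> ?M \<union> ?B = verts G" by auto
  ultimately have ge: "4 * s \<le> card ?A + s + card ?B"
    using L(3)[of i] n by simp
  have "card (?B \<union> ?C) = card ?B + card ?C"
    by (rule card_Un_disjoint) (use fin L(1) in fastforce)+
  moreover have "card (?B \<union> ?C) \<le> 4 * s"
    using n card_mono[OF fin, of "?B \<union> ?C"] by auto
  ultimately have "card ?B \<le> 2 * s" "card ?A \<le> 2 * s"
    using i by (auto simp: P_def)
  with ge have "card ?A \<ge> s" "card ?B \<ge> s" by auto
  \<comment> \<open>An edge would give \<open>lo b \<le> hi a + 1 \<le> i\<close>, while
    \<open>i < lo b\<close>.\<close>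
  moreover have "{a, b} \<notin> edges G" if "a \<in> ?A" "b \<in> ?B" for a b
    using L(2)[of b a] that by (auto simp: insert_commute)
  moreover have "?A \<inter> ?B = {}"
    using L(1) by fastforce
  ultimately show ?thesis using that[of ?A ?B] by blast
qed

text \<open>There are at most \<open>256 ^ s\<close> rectangles, and each is missed by a fraction of at most \<open>(15/16) ^ (90 * s)\<close>
  of the lists; the number 90 is chosen such that \<open>256 * 15 ^ 90 < 16 ^ 90\<close>.\<close>

lemma exists_list_hitting_rectangles:
  fixes V :: "'a set"
  assumes fin: "finite V" and n: "card V = 4 * s" and s: "s > 0"
  obtains ps where "set ps \<subseteq> V \<times> V" "length ps = 90 * s"
    "\<And>A B. A \<subseteq> V \<Longrightarrow> B \<subseteq> V \<Longrightarrow> card A \<ge> s \<Longrightarrow> card B \<ge> s \<Longrightarrow> set ps \<inter> (A \<times> B) \<noteq> {}"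
proof -
  let ?M = "90 * s"
  define \<R> where "\<R> = {(A, B). A \<subseteq> V \<and> B \<subseteq> V \<and> card A \<ge> s \<and> card B \<ge> s}"
  \<comment> \<open>Lists, with repetitions allowed, make the number of choices that miss a fixed
    rectangle an exact power.\<close>
  define bad where "bad = (\<lambda>(A, B). {ps. set ps \<subseteq> V \<times> V - A \<times> B \<and> length ps = ?M})"
  have sub: "\<R> \<subseteq> Pow V \<times> Pow V" by (auto simp: \<R>_def)
  have finR: "finite \<R>" using finite_subset[OF sub] fin by simp
  have cR: "card \<R> \<le> 256 ^ s"
  proof -
    have "card \<R> \<le> card (Pow V \<times> Pow V)"
      using sub fin by (intro card_mono) auto
    also have "\<dots> = 2 ^ (8 * s)"
      using fin n by (simp add: card_cartesian_product card_Pow power_add[symmetric])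
    also have "\<dots> = 256 ^ s" by (simp add: power_mult)
    finally show ?thesis .
  qed
  have cbad: "card (bad r) \<le> (15 * s\<^sup>2) ^ ?M" if rR: "r \<in> \<R>" for r
  proof -
    obtain A B where r: "r = (A, B)" "A \<subseteq> V" "B \<subseteq> V" "card A \<ge> s" "card B \<ge> s"
      using rR by (auto simp: \<R>_def)
    have "s * s \<le> card (A \<times> B)"
      using r by (simp add: card_cartesian_product mult_le_mono)
    moreover have "card (V \<times> V - A \<times> B) = card (V \<times> V) - card (A \<times> B)"
      using r fin by (intro card_Diff_subset) (auto intro: finite_subset)
    moreover have "card (V \<times> V) = 16 * (s * s)"
      using n by (simp add: card_cartesian_product)
    ultimately have "card (V \<times> V - A \<times> B) \<le> 15 * s\<^sup>2"
      by (simp add: power2_eq_square)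
    then have "card (V \<times> V - A \<times> B) ^ ?M \<le> (15 * s\<^sup>2) ^ ?M"
      by (rule power_mono) simp
    then show ?thesis
      using fin r by (simp only: bad_def prod.case card_lists_length_eq finite_Diff finite_SigmaI)
  qed
  have "finite (bad r)" for r
    unfolding bad_def case_prod_beta by (rule finite_lists_length_eq) (use fin in simp)
  then have finU: "finite (\<Union>r\<in>\<R>. bad r)"
    using finR by simp
  have "card (\<Union>r\<in>\<R>. bad r) \<le> (\<Sum>r\<in>\<R>. card (bad r))"
    using finR by (rule card_UN_le)
  also have "\<dots> \<le> card \<R> * (15 * s\<^sup>2) ^ ?M"
    using sum_bounded_above[of \<R> "\<lambda>r. card (bad r)"] cbad by auto
  also have "\<dots> \<le> 256 ^ s * (15 * s\<^sup>2) ^ ?M"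
    by (rule mult_right_mono[OF cR]) simp
  also have "\<dots> = (256 ^ s * 15 ^ ?M) * (s\<^sup>2) ^ ?M"
    by (simp only: power_mult_distrib mult.assoc)
  also have "\<dots> < 16 ^ ?M * (s\<^sup>2) ^ ?M"
  proof (rule mult_strict_right_mono)
    have "256 ^ s * 15 ^ ?M = (256 * 15 ^ 90 :: nat) ^ s"
      by (simp only: power_mult_distrib power_mult)
    also have "\<dots> < (16 ^ 90) ^ s"
      by (rule power_strict_mono) (use s in simp_all)
    finally show "256 ^ s * 15 ^ ?M < (16 :: nat) ^ ?M"
      by (simp only: power_mult)
  qed (use s in simp)
  also have "\<dots> = (16 * s\<^sup>2) ^ ?M"
    by (simp only: power_mult_distrib)
  also have "\<dots> = card {ps. set ps \<subseteq> V \<times> V \<and> length ps = ?M}"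
    using fin n by (simp add: card_lists_length_eq card_cartesian_product power2_eq_square)
  finally have "\<not> {ps. set ps \<subseteq> V \<times> V \<and> length ps = ?M} \<subseteq> (\<Union>r\<in>\<R>. bad r)"
    using card_mono[OF finU] by (meson linorder_not_less)
  then obtain ps where ps: "set ps \<subseteq> V \<times> V" "length ps = ?M" "\<And>r. r \<in> \<R> \<Longrightarrow> ps \<notin> bad r"
    by blast
  show ?thesis
  proof (rule that[OF ps(1,2)])
    fix A B assume "A \<subseteq> V" "B \<subseteq> V" "card A \<ge> s" "card B \<ge> s"
    then have "ps \<notin> bad (A, B)" using ps(3) by (auto simp: \<R>_def)
    then show "set ps \<inter> (A \<times> B) \<noteq> {}" using ps by (auto simp: bad_def)
  qed
qed

lemma exists_unseparable_graph:
  assumes s: "s > 0"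
  obtains H :: "nat ugraph" where "simple_graph H" "no_isolated_vertices H"
    "card (edges H) \<le> 94 * s" "\<not> layered s H"
proof -
  let ?V = "{..<4 * s}"
  obtain ps where ps: "set ps \<subseteq> ?V \<times> ?V" "length ps = 90 * s"
    and hit: "\<And>A B. A \<subseteq> ?V \<Longrightarrow> B \<subseteq> ?V \<Longrightarrow> card A \<ge> s \<Longrightarrow> card B \<ge> s \<Longrightarrow> set ps \<inter> (A \<times> B) \<noteq> {}"
    by (rule exists_list_hitting_rectangles[of ?V s]) (use s in simp_all)
  define E1 where "E1 = (\<lambda>(a, b). {a, b}) ` {p \<in> set ps. fst p \<noteq> snd p}"
  define E2 where "E2 = (\<lambda>v. {0, v}) ` {1..<4 * s}"
  define H where "H = \<lparr>verts = ?V, edges = E1 \<union> E2\<rparr>"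
  have simple: "simple_graph H"
    using ps(1) s by (auto simp: simple_graph_def H_def E1_def E2_def)
  have "\<exists>e\<in>E2. v \<in> e" if "v < 4 * s" for v
    using that s by (cases "v = 0") (auto simp: E2_def intro!: bexI[of _ "1::nat"])
  then have iso: "no_isolated_vertices H"
    by (auto simp: no_isolated_vertices_def H_def)
  have "card E1 \<le> card {p \<in> set ps. fst p \<noteq> snd p}"
    unfolding E1_def by (rule card_image_le) simp
  also have "\<dots> \<le> card (set ps)" by (rule card_mono) auto
  also have "\<dots> \<le> 90 * s" using card_length[of ps] ps by simp
  finally have "card E1 \<le> 90 * s" .
  moreover have "card E2 \<le> 4 * s"
    unfolding E2_def by (rule order_trans[OF card_image_le]) auto
  ultimately have cE: "card (edges H) \<le> 94 * s"
    using card_Un_le[of E1 E2] by (simp add: H_def)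
  have "\<not> layered s H"
  proof
    assume "layered s H"
    then obtain A B where AB: "A \<subseteq> verts H" "B \<subseteq> verts H" "A \<inter> B = {}" "card A \<ge> s" "card B \<ge> s"
      "\<And>a b. a \<in> A \<Longrightarrow> b \<in> B \<Longrightarrow> {a, b} \<notin> edges H"
      using layered_separator[OF _ simple] s by (auto simp: H_def)
    then obtain a b where "(a, b) \<in> set ps" "a \<in> A" "b \<in> B"
      using hit[of A B] by (auto simp: H_def)
    moreover from this have "{a, b} \<in> E1"
      using AB(3) by (force simp: E1_def)
    ultimately show False
      using AB(6) by (auto simp: H_def)
  qed
  then show ?thesis
    using that[OF simple iso cE] by blast
qed

section \<open>The hypercube\<close>

definition cube :: "nat \<Rightarrow> bool list set" where
  "cube d = {x. length x = d}"

text \<open>A common prefix and suffix instead of a count of differing positions: extending both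
  words on either side then involves no index arithmetic.\<close>

definition adj :: "bool list \<Rightarrow> bool list \<Rightarrow> bool" where
  "adj x y \<longleftrightarrow> (\<exists>u b b' v. x = u @ b # v \<and> y = u @ b' # v \<and> b \<noteq> b')"

lemma adj_sym: "adj x y \<Longrightarrow> adj y x"
  unfolding adj_def by blast

lemma adj_append_left: "adj x y \<Longrightarrow> adj (z @ x) (z @ y)"
  unfolding adj_def by (elim exE, rule_tac x = "z @ u" in exI) auto

lemma adj_append_right: "adj x y \<Longrightarrow> adj (x @ z) (y @ z)"
  unfolding adj_def by (elim exE, rule_tac x = u in exI) auto

lemma adj_Cons: "adj x y \<Longrightarrow> adj (b # x) (b # y)"
  using adj_append_left[of x y "[b]"] by simp

lemma adj_flip_hd: "b \<noteq> b' \<Longrightarrow> adj (b # x) (b' # x)"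
  unfolding adj_def by (rule exI[of _ "[]"]) auto

lemma adj_length: "adj x y \<Longrightarrow> length x = length y"
  unfolding adj_def by auto

lemma adj_iff_card_diff:
  assumes "length x = d" "length y = d"
  shows "adj x y \<longleftrightarrow> card {i. i < d \<and> x ! i \<noteq> y ! i} = 1"
proof
  assume "adj x y"
  then obtain u b b' v where xy: "x = u @ b # v" "y = u @ b' # v" "b \<noteq> b'"
    by (auto simp: adj_def)
  have "(x ! i \<noteq> y ! i) = (i = length u)" for i
    using xy by (cases "i - length u") (auto simp: nth_append)
  then have "{i. i < d \<and> x ! i \<noteq> y ! i} = {length u}"
    using assms xy by auto
  then show "card {i. i < d \<and> x ! i \<noteq> y ! i} = 1" by simp
next
  assume "card {i. i < d \<and> x ! i \<noteq> y ! i} = 1"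
  then obtain i where i: "{i. i < d \<and> x ! i \<noteq> y ! i} = {i}"
    by (auto simp: card_1_singleton_iff)
  then have id: "i < d" "x ! i \<noteq> y ! i" and eq: "\<And>j. j < d \<Longrightarrow> j \<noteq> i \<Longrightarrow> x ! j = y ! j"
    by blast+
  have x: "x = take i x @ x ! i # drop (Suc i) x"
    by (rule id_take_nth_drop) (use id assms in simp)
  have y: "y = take i y @ y ! i # drop (Suc i) y"
    by (rule id_take_nth_drop) (use id assms in simp)
  have "take i x = take i y" "drop (Suc i) x = drop (Suc i) y"
    using assms id eq by (auto intro!: nth_equalityI)
  with x y have "x = take i x @ x ! i # drop (Suc i) x" "y = take i x @ y ! i # drop (Suc i) x"
    by simp_all
  with id(2) show "adj x y"
    unfolding adj_def by blast
qed

lemma edge_hypercube_iff: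
  "{x, y} \<in> edges (hypercube d) \<longleftrightarrow> length x = d \<and> length y = d \<and> adj x y"
proof -
  have "edges (hypercube d) = {{x, y} | x y. length x = d \<and> length y = d \<and> adj x y}"
  proof -
    have "length x = d \<and> length y = d \<and> card {i. i < d \<and> x ! i \<noteq> y ! i} = 1 \<longleftrightarrow>
        length x = d \<and> length y = d \<and> adj x y" for x y
      using adj_iff_card_diff by blast
    then show ?thesis by (simp only: hypercube_def ugraph.simps)
  qed
  moreover have "adj x y \<longleftrightarrow> adj y x"
    using adj_sym by blast
  ultimately show ?thesis
    by (auto simp: doubleton_eq_iff)
qed

lemma verts_hypercube: "verts (hypercube d) = cube d"
  by (simp add: hypercube_def cube_def)

lemma finite_cube: "finite (cube d)"
  using finite_lists_length_eq[of "UNIV :: bool set" d] by (simp add: cube_def)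

section \<open>Hamming weights\<close>

definition weight :: "bool list \<Rightarrow> nat" where
  "weight x = length (filter id x)"

lemma weight_adj: "adj x y \<Longrightarrow> weight x = Suc (weight y) \<or> weight y = Suc (weight x)"
  by (auto simp: adj_def weight_def split: if_splits)

text \<open>Splitting off the first bit gives Pascal's recursion.\<close>

lemma card_weight_eq: "card {x \<in> cube d. weight x = i} = d choose i"
proof (induction d arbitrary: i)
  case 0
  have "{x \<in> cube 0. weight x = i} = (if i = 0 then {[]} else {})"
    by (auto simp: cube_def weight_def)
  then show ?case by (cases i) (simp_all only: if_True if_False, simp_all)
next
  case (Suc d)
  let ?F = "(\<lambda>i. {x \<in> cube d. weight x = i})"
  have fin: "finite (?F j)" for j using finite_cube by simp
  have split: "{x \<in> cube (Suc d). weight x = i} =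
      (#) False ` ?F i \<union> (#) True ` {x \<in> cube d. Suc (weight x) = i}"
    by (auto simp: cube_def weight_def length_Suc_conv image_iff)
  show ?case
  proof (cases i)
    case 0
    then show ?thesis using Suc.IH[of 0] split by (simp add: card_image)
  next
    case (Suc j)
    then have "card {x \<in> cube (Suc d). weight x = i} = card (?F i) + card (?F j)"
      unfolding split using fin by (subst card_Un_disjoint) (auto simp: card_image)
    then show ?thesis using Suc.IH Suc by simp
  qed
qed

section \<open>The upper bound\<close>

text \<open>Each vertex occupies the single layer of its weight. No level of the cube is larger than
  the middle one, and an edge changes the weight by one.\<close>

lemma layered_hypercube: "layered (d choose (d div 2)) (hypercube d)"
proof (rule layeredI[of _ weight weight])
  fix i
  have "{v \<in> cube d. weight v \<le> i \<and> i \<le> weight v} = {v \<in> cube d. weight v = i}" by auto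
  then show "card {v \<in> verts (hypercube d). weight v \<le> i \<and> i \<le> weight v} \<le> d choose (d div 2)"
    using binomial_maximum[of d i] by (simp add: verts_hypercube card_weight_eq)
next
  fix u v assume "{u, v} \<in> edges (hypercube d)"
  then show "weight u \<le> weight v + 1" using weight_adj[of u v] by (auto simp: edge_hypercube_iff)
qed simp

section \<open>Size of the middle binomial coefficient\<close>

text \<open>Consecutive central binomials have ratio \<open>2 * (2 * k + 1) / (k + 1)\<close>, and
  \<open>(2 * k + 3) * (2 * k + 1) \<le> 4 * (k + 1)\<^sup>2\<close> closes the induction. The
  factor \<open>2 * k + 1\<close> also serves the odd dimension \<open>2 * k + 1\<close>.\<close>

lemma central_binomial_square_le: "(2 * k + 1) * ((2 * k) choose k)\<^sup>2 \<le> 16 ^ k"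
proof (induction k)
  case (Suc k)
  let ?b = "(2 * k) choose k" and ?c = "(2 * Suc k) choose (Suc k)"
  let ?a = "Suc (2 * k) choose k"
  have sym: "Suc (2 * k) choose Suc k = ?a"
  proof -
    have "Suc (2 * k) - k = Suc k" "k \<le> Suc (2 * k)" by simp_all
    then show ?thesis using binomial_symmetric[of k "Suc (2 * k)"] by metis
  qed
  have c: "?c = 2 * ?a"
    using binomial_Suc_Suc[of "Suc (2 * k)" k] sym by (simp del: binomial_Suc_Suc)
  have "Suc k * ?a = Suc (2 * k) * ?b"
    using Suc_times_binomial_eq[of "2 * k" k] unfolding sym by (simp only: mult.commute)
  then have cb: "Suc k * ?c = 2 * (Suc (2 * k) * ?b)"
    unfolding c by (simp only: mult.left_commute[of _ 2])
  \<comment> \<open>Only the ratio and the induction hypothesis matter from here on, so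
    \<open>b\<close> and \<open>c\<close> stand for the binomials.\<close>
  have "(2 * Suc k + 1) * c\<^sup>2 \<le> 16 ^ Suc k"
    if cb: "Suc k * c = 2 * (Suc (2 * k) * b)" and IH: "(2 * k + 1) * b\<^sup>2 \<le> 16 ^ k" for b c :: nat
  proof -
    have "(Suc k)\<^sup>2 * ((2 * Suc k + 1) * c\<^sup>2) = (2 * Suc k + 1) * (Suc k * c)\<^sup>2"
      by (simp only: power_mult_distrib mult_ac)
    also have "\<dots> = 4 * ((2 * k + 3) * (2 * k + 1)) * ((2 * k + 1) * b\<^sup>2)"
      unfolding cb by (simp add: power2_eq_square algebra_simps)
    also have "\<dots> \<le> (16 * (Suc k)\<^sup>2) * 16 ^ k"
      by (rule mult_le_mono[OF _ IH]) (simp add: power2_eq_square algebra_simps)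
    finally have "(Suc k)\<^sup>2 * ((2 * Suc k + 1) * c\<^sup>2) \<le> (Suc k)\<^sup>2 * 16 ^ Suc k"
      by (simp only: power_Suc mult_ac)
    then show ?thesis by (simp only: mult_le_cancel1) simp
  qed
  from this[OF cb Suc.IH] show ?case .
qed simp

text \<open>The even case is the central bound. The odd one loses at most a factor 2 in the binomial
  by Pascal's rule, which the extra factor 4 on the right absorbs after squaring.\<close>

lemma middle_binomial_square_le: "d * (d choose (d div 2))\<^sup>2 \<le> 4 ^ d"
proof (cases "even d")
  case True
  then obtain k where "d = 2 * k" by blast
  then show ?thesis using central_binomial_square_le[of k] by (simp add: power_mult)
next
  case False
  then obtain k where d: "d = 2 * k + 1" using oddE by blast
  have "(2 * k + 1) choose k \<le> 2 * ((2 * k) choose k)"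
    using binomial_maximum[of "2 * k" "k - 1"] by (cases k) simp_all
  then have "((2 * k + 1) choose k)\<^sup>2 \<le> 4 * ((2 * k) choose k)\<^sup>2"
    using power_mono[of _ _ 2] by (fastforce simp: power_mult_distrib)
  then have "(2 * k + 1) * ((2 * k + 1) choose k)\<^sup>2 \<le> (2 * k + 1) * (4 * ((2 * k) choose k)\<^sup>2)"
    by (rule mult_le_mono2)
  then have "d * (d choose (d div 2))\<^sup>2 \<le> 4 * ((2 * k + 1) * ((2 * k) choose k)\<^sup>2)"
    using d by (simp del: binomial_Suc_Suc)
  also have "\<dots> \<le> 4 ^ d"
    using central_binomial_square_le[of k] d by (simp add: power_mult)
  finally show ?thesis .
qed

lemma middle_binomial_le:
  assumes "d \<ge> 1"
  shows "real (d choose (d div 2)) \<le> 2 ^ d / sqrt (real d)"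
proof -
  let ?s = "d choose (d div 2)"
  have "(real ?s * sqrt (real d))\<^sup>2 = real (d * ?s\<^sup>2)"
    by (simp add: power_mult_distrib)
  also have "\<dots> \<le> real (4 ^ d)"
    using middle_binomial_square_le by (simp only: of_nat_le_iff)
  also have "\<dots> = (2 ^ d)\<^sup>2"
    using power_mult[of "2 :: real" 2 d] power_mult[of "2 :: real" d 2] by (simp add: mult.commute)
  finally have "real ?s * sqrt (real d) \<le> 2 ^ d"
    by (rule power2_le_imp_le) simp
  then show ?thesis using assms by (simp add: field_simps)
qed

lemma hypercube_not_universal:
  assumes "d \<ge> 1"
  shows "\<not> minor_universal (94 * 2 ^ d / sqrt (real d)) (hypercube d)"
proof
  assume U: "minor_universal (94 * 2 ^ d / sqrt (real d)) (hypercube d)"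
  let ?s = "d choose (d div 2)"
  have "?s > 0" by simp
  then obtain H :: "nat ugraph" where H: "simple_graph H" "no_isolated_vertices H"
    "card (edges H) \<le> 94 * ?s" "\<not> layered ?s H"
    using exists_unseparable_graph by metis
  have "real (card (edges H)) \<le> real (94 * ?s)"
    using H(3) by (simp only: of_nat_le_iff)
  also have "\<dots> \<le> 94 * 2 ^ d / sqrt (real d)"
    using middle_binomial_le[OF assms] by simp
  finally have "is_minor H (hypercube d)"
    using minor_universalD[OF U H(1,2)] by simp
  then show False
    using layered_minor[OF _ simple_graph_hypercube layered_hypercube] H(4) by blast
qed

section \<open>Gray codes and routing\<close>

text \<open>The reflected Gray code: the second half runs through the first in reverse, so that the
  two words in the middle differ only in the leading bit.\<close>

fun gray :: "nat \<Rightarrow> nat \<Rightarrow> bool list" where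
  "gray 0 i = []"
| "gray (Suc n) i = (if i < 2 ^ n then False # gray n i else True # gray n (2 ^ Suc n - 1 - i))"

lemma length_gray [simp]: "length (gray n i) = n"
  by (induction n arbitrary: i) auto

lemma inj_on_gray: "inj_on (gray n) {..<2 ^ n}"
proof (induction n)
  case (Suc n)
  have *: "i = j" if "gray n i = gray n j" "i < 2 ^ n" "j < 2 ^ n" for i j
    using Suc that by (auto simp: inj_on_def)
  show ?case
  proof (rule inj_onI)
    fix i j assume ij: "i \<in> {..<2 ^ Suc n}" "j \<in> {..<2 ^ Suc n}" "gray (Suc n) i = gray (Suc n) j"
    show "i = j"
    proof (cases "i < 2 ^ n")
      case True
      with ij *[of i j] show ?thesis by (auto split: if_splits)
    next
      case False
      with ij have "2 ^ Suc n - 1 - i = 2 ^ Suc n - 1 - j"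
        by (intro *) (auto split: if_splits)
      with ij show ?thesis by simp
    qed
  qed
qed (simp add: inj_on_def)

lemma adj_gray_Suc: "Suc i < 2 ^ n \<Longrightarrow> adj (gray n i) (gray n (Suc i))"
proof (induction n arbitrary: i)
  case (Suc n)
  consider "Suc i < 2 ^ n" | "Suc i = 2 ^ n" | "i \<ge> 2 ^ n" by linarith
  then show ?case
  proof cases
    case 1
    then show ?thesis using Suc.IH[of i] by (simp add: adj_Cons)
  next
    case 2
    then have "gray (Suc n) i = False # gray n i" "gray (Suc n) (Suc i) = True # gray n i"
      by (auto simp flip: 2)
    then show ?thesis by (simp add: adj_flip_hd del: gray.simps)
  next
    case 3
    define j where "j = 2 ^ Suc n - 1 - Suc i"
    have j: "2 ^ Suc n - 1 - i = Suc j" "Suc j < 2 ^ n"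
      using 3 Suc.prems by (auto simp: j_def)
    then have "gray (Suc n) i = True # gray n (Suc j)" "gray (Suc n) (Suc i) = True # gray n j"
      using 3 by (auto simp: j_def)
    then show ?thesis
      using adj_Cons[OF adj_sym[OF Suc.IH[OF j(2)]]] by (simp del: gray.simps)
  qed
qed simp

section \<open>Rearrangeability by alternating colourings\<close>

text \<open>\<open>f\<close> and \<open>g\<close> are perfect matchings, whose union consists of
  even alternating cycles and is therefore 2-colourable. The induction deletes one pair of
  \<open>f\<close> and shortens its cycle, so that no cycle has to be constructed.\<close>

lemma two_involutions_colouring:
  assumes "finite X"
    and "\<And>x. x \<in> X \<Longrightarrow> f x \<in> X \<and> f x \<noteq> x \<and> f (f x) = x"
    and "\<And>x. x \<in> X \<Longrightarrow> g x \<in> X \<and> g x \<noteq> x \<and> g (g x) = x"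
  shows "\<exists>c :: 'a \<Rightarrow> bool. \<forall>x\<in>X. c (f x) \<noteq> c x \<and> c (g x) \<noteq> c x"
  using assms
proof (induction X arbitrary: g rule: finite_psubset_induct)
  case (psubset X)
  note f = psubset.prems(1) and g = psubset.prems(2)
  show ?case
  proof (cases "X = {}")
    case False
    then obtain x where x: "x \<in> X" by blast
    define y where "y = f x"
    have y: "y \<in> X" "y \<noteq> x" "f y = x" using f[OF x] by (auto simp: y_def)
    define Y where "Y = X - {x, y}"
    have YX: "Y \<subset> X" using x by (auto simp: Y_def)
    have fY: "f z \<in> Y \<and> f z \<noteq> z \<and> f (f z) = z" if "z \<in> Y" for z
      using f[of z] that y by (auto simp: Y_def y_def)
    define a b where "a = g x" and "b = g y"
    \<comment> \<open>Removing \<open>x\<close> and \<open>y\<close> from their alternating cycle joins their \<open>g\<close>-neighbours \<open>a\<close> and \<open>b\<close>.\<close>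
    define h where "h = (\<lambda>z. if z = a then b else if z = b then a else g z)"
    have ab: "g a = x" "g b = y" "a \<noteq> b" "a \<in> X" "b \<in> X" "a \<noteq> x" "b \<noteq> y"
      using g[OF x] g[OF y(1)] y(2) by (auto simp: a_def b_def)
    have gz: "g z \<noteq> x" "g z \<noteq> y" "g z \<noteq> a" "g z \<noteq> b" if "z \<in> Y" "z \<noteq> a" "z \<noteq> b" for z
    proof -
      have "g (g z) = z" "z \<noteq> x" "z \<noteq> y" using g[of z] that by (auto simp: Y_def)
      then show "g z \<noteq> x" "g z \<noteq> y" "g z \<noteq> a" "g z \<noteq> b"
        using that ab a_def b_def by metis+
    qed
    have hY: "h z \<in> Y \<and> h z \<noteq> z \<and> h (h z) = z" if z: "z \<in> Y" for z
    proof (cases "z = a \<or> z = b")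
      case True
      then have "a \<in> Y \<and> b \<in> Y"
        using z ab y by (auto simp: Y_def a_def b_def)
      with True ab show ?thesis by (auto simp: h_def)
    next
      case False
      with gz[OF z] g[of z] z show ?thesis by (auto simp: h_def Y_def)
    qed
    obtain c :: "'a \<Rightarrow> bool" where c: "\<And>z. z \<in> Y \<Longrightarrow> c (f z) \<noteq> c z \<and> c (h z) \<noteq> c z"
      using psubset.IH[OF YX fY hY] by blast
    show ?thesis
    proof (cases "a = y")
      case True
      \<comment> \<open>Here \<open>f\<close> and \<open>g\<close> both match \<open>x\<close> with
        \<open>y\<close>, which form a cycle of their own.\<close>
      define c' where "c' = c(x := True, y := False)"
      have bx: "b = x" using True ab by (simp add: b_def)
      have "c' (f z) \<noteq> c' z \<and> c' (g z) \<noteq> c' z" if z: "z \<in> X" for z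
      proof (cases "z \<in> Y")
        case zY: True
        then have "z \<noteq> a" "z \<noteq> b" using True bx by (auto simp: Y_def)
        with c[OF zY] fY[OF zY] hY[OF zY] zY show ?thesis
          by (auto simp: c'_def h_def Y_def)
      next
        case False
        then have "z = x \<or> z = y" using z by (auto simp: Y_def)
        then show ?thesis using True bx y by (auto simp: c'_def a_def b_def y_def)
      qed
      then show ?thesis by blast
    next
      case False
      have bx: "b \<noteq> x" using False ab by (auto simp: a_def)
      have abY: "a \<in> Y" "b \<in> Y" using False ab bx by (auto simp: Y_def)
      have cab: "c b \<noteq> c a" using c[OF abY(1)] by (auto simp: h_def)
      \<comment> \<open>\<open>h\<close> matches \<open>a\<close> with \<open>b\<close>, so these
        have opposite colours; giving \<open>x\<close> the colour of \<open>b\<close> and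
        \<open>y\<close> that of \<open>a\<close> extends the alternation.\<close>
      define c' where "c' = c(x := c b, y := c a)"
      have "c' (f z) \<noteq> c' z \<and> c' (g z) \<noteq> c' z" if z: "z \<in> X" for z
      proof (cases "z \<in> Y")
        case zY: True
        then have nz: "z \<noteq> x" "z \<noteq> y" by (auto simp: Y_def)
        have 1: "c' (f z) \<noteq> c' z"
          using c[OF zY] fY[OF zY] nz by (auto simp: c'_def Y_def)
        have 2: "c' (g z) \<noteq> c' z"
        proof (cases "z = a \<or> z = b")
          case True
          then show ?thesis using ab nz cab y by (auto simp: c'_def)
        next
          case False
          with gz[OF zY] c[OF zY] nz show ?thesis by (auto simp: c'_def h_def)
        qed
        from 1 2 show ?thesis by blast
      next
        case False
        then have "z = x \<or> z = y" using z by (auto simp: Y_def)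
        moreover have "a \<noteq> x" "a \<noteq> y" "b \<noteq> x" "b \<noteq> y" using abY by (auto simp: Y_def)
        ultimately show ?thesis using y cab by (auto simp: c'_def y_def[symmetric] a_def[symmetric] b_def[symmetric])
      qed
      then show ?thesis by blast
    qed
  qed simp
qed

text \<open>\<open>\<sigma> t x\<close> is the position after \<open>t\<close> rounds of the token that starts at \<open>x\<close>.\<close>

definition routes :: "nat \<Rightarrow> (nat \<Rightarrow> bool list \<Rightarrow> bool list) \<Rightarrow> (bool list \<Rightarrow> bool list) \<Rightarrow> bool" where
  "routes k \<sigma> \<pi> \<longleftrightarrow>
     (\<forall>t\<le>2 * k. inj_on (\<sigma> t) (cube k) \<and> \<sigma> t ` cube k \<subseteq> cube k) \<and>
     (\<forall>x\<in>cube k. \<sigma> 0 x = x \<and> \<sigma> (2 * k) x = \<pi> x) \<and>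
     (\<forall>t<2 * k. \<forall>x\<in>cube k. \<sigma> (Suc t) x = \<sigma> t x \<or> adj (\<sigma> t x) (\<sigma> (Suc t) x))"

text \<open>One level of the Benes network: the first round moves every token to the half-cube given by its
  colour, the two half-cubes are routed independently, and the last round corrects the first bit. The
  colouring separates tokens that differ only in the first bit at the start or at the end.\<close>

lemma exists_routes:
  assumes "bij_betw \<pi> (cube k) (cube k)"
  shows "\<exists>\<sigma>. routes k \<sigma> \<pi>"
  using assms
proof (induction k arbitrary: \<pi>)
  case 0
  then have "\<pi> [] = []" by (auto simp: cube_def bij_betw_def)
  then show ?case by (intro exI[of _ "\<lambda>_ x. x"]) (auto simp: routes_def cube_def)
next
  case (Suc k)
  let ?C = "cube (Suc k)"
  define flip where "flip = (\<lambda>x. (\<not> hd x) # tl x)"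
  have C: "\<exists>b w. x = b # w \<and> w \<in> cube k" if "x \<in> ?C" for x
    using that by (auto simp: cube_def length_Suc_conv)
  have CI: "b # w \<in> ?C" if "w \<in> cube k" for b w using that by (auto simp: cube_def)
  have flip: "flip x \<in> ?C \<and> flip x \<noteq> x \<and> flip (flip x) = x" if "x \<in> ?C" for x
    using C[OF that] CI by (auto simp: flip_def)
  have inj: "inj_on \<pi> ?C" and im: "\<pi> ` ?C = ?C" using Suc.prems by (auto simp: bij_betw_def)
  have \<pi>C: "\<pi> x \<in> ?C" if "x \<in> ?C" for x using im that by blast
  define \<rho> where "\<rho> = inv_into ?C \<pi>"
  have \<rho>: "\<rho> y \<in> ?C" "\<pi> (\<rho> y) = y" if "y \<in> ?C" for y
    using that im by (auto simp: \<rho>_def inv_into_into f_inv_into_f)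
  have \<rho>\<pi>: "\<rho> (\<pi> x) = x" if "x \<in> ?C" for x
    using that inj by (simp add: \<rho>_def)
  \<comment> \<open>\<open>g\<close> pairs the tokens whose targets differ only in the first
    bit.\<close>
  define g where "g = (\<lambda>x. \<rho> (flip (\<pi> x)))"
  have g: "g x \<in> ?C \<and> g x \<noteq> x \<and> g (g x) = x" if "x \<in> ?C" for x
  proof -
    have f: "flip (\<pi> x) \<in> ?C" "flip (\<pi> x) \<noteq> \<pi> x" "flip (flip (\<pi> x)) = \<pi> x"
      using flip[OF \<pi>C[OF that]] by auto
    then have "\<pi> (g x) = flip (\<pi> x)" "g x \<in> ?C" using \<rho> by (auto simp: g_def)
    with f that \<rho>\<pi> show ?thesis by (auto simp: g_def)
  qed
  obtain c :: "bool list \<Rightarrow> bool" where c: "\<And>x. x \<in> ?C \<Longrightarrow> c (flip x) \<noteq> c x \<and> c (g x) \<noteq> c x"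
    using two_involutions_colouring[OF finite_cube flip g] by blast
  \<comment> \<open>\<open>e a w\<close> is the token of colour \<open>a\<close> among the two with
    tail \<open>w\<close>; \<open>flip\<close> pairs these two, so their colours differ.\<close>
  define e where "e = (\<lambda>a w. (c (True # w) = a) # w)"
  have eC: "e a w \<in> ?C" and tle: "tl (e a w) = w" if "w \<in> cube k" for a w
    using that CI by (auto simp: e_def)
  have ce: "c (e a w) = a" if "w \<in> cube k" for a w
    using c[of "True # w"] CI[OF that, of True]
    by (cases "c (True # w) = a") (auto simp: e_def flip_def)
  have ex: "e (c x) (tl x) = x" if x: "x \<in> ?C" for x
  proof -
    obtain b w where bw: "x = b # w" "w \<in> cube k" using C[OF x] by blast
    have "c (False # w) \<noteq> c (True # w)"
      using c[of "True # w"] CI bw by (auto simp: flip_def)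
    with bw show ?thesis by (cases b) (auto simp: e_def)
  qed
  have tlC: "tl x \<in> cube k" if "x \<in> ?C" for x using that by (auto simp: cube_def)
  \<comment> \<open>Within one colour the target tails are distinct: two targets with the same tail
    coincide or belong to tokens paired by \<open>g\<close>, whose colours differ. So each half-cube
    faces a permutation problem of its own.\<close>
  have "bij_betw (\<lambda>w. tl (\<pi> (e a w))) (cube k) (cube k)" for a
  proof -
    have "inj_on (\<lambda>w. tl (\<pi> (e a w))) (cube k)"
    proof (rule inj_onI)
      fix v w assume vw: "v \<in> cube k" "w \<in> cube k" "tl (\<pi> (e a v)) = tl (\<pi> (e a w))"
      have "\<pi> (e a v) = \<pi> (e a w) \<or> \<pi> (e a v) = flip (\<pi> (e a w))"
        using C[OF \<pi>C[OF eC[OF vw(1), of a]]] C[OF \<pi>C[OF eC[OF vw(2), of a]]] vw(3)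
        by (auto simp: flip_def)
      moreover have "\<pi> (e a v) \<noteq> flip (\<pi> (e a w))"
      proof
        assume "\<pi> (e a v) = flip (\<pi> (e a w))"
        then have "e a v = g (e a w)"
          using \<rho>\<pi>[OF eC[OF vw(1), of a]] by (simp add: g_def)
        then show False
          using c[OF eC[OF vw(2), of a]] ce[OF vw(1), of a] ce[OF vw(2), of a] by auto
      qed
      ultimately have "e a v = e a w"
        using inj eC vw by (auto simp: inj_on_def)
      then show "v = w" using tle vw by metis
    qed
    moreover have "(\<lambda>w. tl (\<pi> (e a w))) ` cube k \<subseteq> cube k"
      using tlC \<pi>C eC by auto
    ultimately show ?thesis
      unfolding bij_betw_def using endo_inj_surj[OF finite_cube] by blast
  qed
  then have "\<forall>a. \<exists>\<sigma>. routes k \<sigma> (\<lambda>w. tl (\<pi> (e a w)))" using Suc.IH by blast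
  then obtain \<tau> where \<tau>: "\<And>a. routes k (\<tau> a) (\<lambda>w. tl (\<pi> (e a w)))" by metis
  \<comment> \<open>Time in the half-cubes lags one round behind: at time 1 the first bit is the
    colour, at time \<open>2 * k + 1\<close> the tail is already the final one, and the last round
    sets the first bit.\<close>
  define \<sigma> where "\<sigma> = (\<lambda>t x. if t = 0 then x else if t = 2 * Suc k then \<pi> x
      else c x # \<tau> (c x) (t - 1) (tl x))"
  have \<sigma>m: "\<sigma> (Suc t) x = c x # \<tau> (c x) t (tl x)" if "t \<le> 2 * k" for t x
    using that by (simp add: \<sigma>_def)
  have \<sigma>0: "\<sigma> 0 x = x" and \<sigma>l: "\<sigma> (2 * Suc k) x = \<pi> x" for x by (auto simp: \<sigma>_def)
  have \<tau>C: "\<tau> a t w \<in> cube k" if "t \<le> 2 * k" "w \<in> cube k" for a t w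
    using \<tau>[of a] that by (auto simp: routes_def)
  have \<tau>inj: "v = w" if "\<tau> a t v = \<tau> a t w" "t \<le> 2 * k" "v \<in> cube k" "w \<in> cube k" for a t v w
    using \<tau>[of a] that by (auto simp: routes_def inj_on_def)
  have "inj_on (\<sigma> t) ?C \<and> \<sigma> t ` ?C \<subseteq> ?C" if t: "t \<le> 2 * Suc k" for t
  proof -
    consider "t = 0" | "t = 2 * Suc k" | s where "t = Suc s" "s \<le> 2 * k"
      using t by (cases t) (auto simp: le_Suc_eq)
    then show ?thesis
    proof cases
      case 1
      then show ?thesis by (auto simp: \<sigma>0 inj_on_def)
    next
      case 2
      then have "\<sigma> t = \<pi>" by (simp add: \<sigma>_def fun_eq_iff)
      then show ?thesis using inj im by simp
    next
      case 3
      have "inj_on (\<sigma> t) ?C"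
      proof (rule inj_onI)
        fix x y assume xy: "x \<in> ?C" "y \<in> ?C" "\<sigma> t x = \<sigma> t y"
        then have "c x = c y" "tl x = tl y"
          using 3 \<sigma>m \<tau>inj[of _ s "tl x" "tl y"] tlC by auto
        then have "e (c x) (tl x) = e (c y) (tl y)" by simp
        then show "x = y" using ex[OF xy(1)] ex[OF xy(2)] by simp
      qed
      then show ?thesis using 3 \<sigma>m \<tau>C tlC CI by auto
    qed
  qed
  moreover have "\<sigma> (Suc t) x = \<sigma> t x \<or> adj (\<sigma> t x) (\<sigma> (Suc t) x)"
    if t: "t < 2 * Suc k" and x: "x \<in> ?C" for t x
  proof -
    obtain b w where bw: "x = b # w" "w \<in> cube k" using C[OF x] by blast
    consider "t = 0" | "t = Suc (2 * k)" | s where "t = Suc s" "s < 2 * k"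
      using t by (cases t) (auto simp: less_Suc_eq)
    then show ?thesis
    proof cases
      case 1
      have "\<sigma> (Suc t) x = c x # w"
        using 1 \<sigma>m[of 0 x] \<tau>[of "c x"] bw by (auto simp: routes_def)
      then show ?thesis
        using 1 bw \<sigma>0 adj_flip_hd[of b "c x" w] by auto
    next
      case 2
      obtain b' w' where bw': "\<pi> x = b' # w'" "w' \<in> cube k" using C[OF \<pi>C[OF x]] by blast
      have "\<sigma> t x = c x # w'"
        using 2 \<sigma>m[of "2 * k" x] \<tau>[of "c x"] tlC[OF x] ex[OF x] bw' by (auto simp: routes_def)
      moreover have "\<sigma> (Suc t) x = b' # w'"
        using 2 \<sigma>l[of x] bw' by simp
      ultimately show ?thesis
        using adj_flip_hd[of "c x" b' w'] by (cases "c x = b'") simp_all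
    next
      case 3
      then have "\<tau> (c x) (Suc s) (tl x) = \<tau> (c x) s (tl x) \<or>
          adj (\<tau> (c x) s (tl x)) (\<tau> (c x) (Suc s) (tl x))"
        using \<tau>[of "c x"] tlC[OF x] by (auto simp: routes_def)
      then show ?thesis
        using 3 \<sigma>m[of s x] \<sigma>m[of "Suc s" x] adj_Cons by auto
    qed
  qed
  ultimately have "routes (Suc k) \<sigma> \<pi>"
    unfolding routes_def using \<sigma>0 \<sigma>l by blast
  then show ?case by blast
qed

section \<open>Minor models\<close>

text \<open>Connectedness phrased through cuts behaves well under contraction.\<close>

definition cut_connected :: "'a set set \<Rightarrow> 'a set \<Rightarrow> bool" where
  "cut_connected E S \<longleftrightarrow> (\<forall>X\<subseteq>S. X \<noteq> {} \<longrightarrow> X \<noteq> S \<longrightarrow> (\<exists>x\<in>X. \<exists>y\<in>S - X. {x, y} \<in> E))"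

lemma cut_connected_singleton: "cut_connected E {x}"
  by (auto simp: cut_connected_def)

text \<open>A cut of the union either cuts \<open>A\<close> or \<open>B\<close> properly, or
  contains one of them and misses the other; in the last case the link between \<open>a\<close> and
  \<open>b\<close> crosses it.\<close>

lemma cut_connected_Un:
  assumes A: "cut_connected E A" and B: "cut_connected E B"
    and ab: "a \<in> A" "b \<in> B" "a = b \<or> {a, b} \<in> E"
  shows "cut_connected E (A \<union> B)"
  unfolding cut_connected_def
proof (intro allI impI)
  fix X assume X: "X \<subseteq> A \<union> B" "X \<noteq> {}" "X \<noteq> A \<union> B"
  show "\<exists>x\<in>X. \<exists>y\<in>A \<union> B - X. {x, y} \<in> E"
  proof (cases "X \<inter> A \<noteq> {} \<and> X \<inter> A \<noteq> A")
    case True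
    then obtain x y where "x \<in> X \<inter> A" "y \<in> A - X \<inter> A" "{x, y} \<in> E"
      using A unfolding cut_connected_def by (meson Int_lower2)
    then show ?thesis by blast
  next
    case nA: False
    show ?thesis
    proof (cases "X \<inter> B \<noteq> {} \<and> X \<inter> B \<noteq> B")
      case True
      then obtain x y where "x \<in> X \<inter> B" "y \<in> B - X \<inter> B" "{x, y} \<in> E"
        using B unfolding cut_connected_def by (meson Int_lower2)
      then show ?thesis by blast
    next
      case False
      with nA X ab have "a \<in> X \<and> b \<notin> X \<or> b \<in> X \<and> a \<notin> X" by blast
      with ab have "a \<in> X \<and> b \<notin> X \<and> {a, b} \<in> E \<or> b \<in> X \<and> a \<notin> X \<and> {b, a} \<in> E"
        by (auto simp: insert_commute)
      with ab show ?thesis by blast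
    qed
  qed
qed

lemma cut_connected_insert:
  assumes "cut_connected E B" "b \<in> B" "a = b \<or> {a, b} \<in> E"
  shows "cut_connected E (insert a B)"
  using cut_connected_Un[OF cut_connected_singleton[of E a] assms(1) _ assms(2,3)] by simp

text \<open>One round of a token's walk has this shape; consecutive vertices may coincide because a
  token may stay where it is.\<close>

lemma cut_connected_path4:
  assumes "a = b \<or> {a, b} \<in> E" "b = c \<or> {b, c} \<in> E" "c = d \<or> {c, d} \<in> E"
  shows "cut_connected E {a, b, c, d}"
proof -
  have "cut_connected E {c, d}"
    using cut_connected_insert[OF cut_connected_singleton _ assms(3)] by simp
  then have "cut_connected E {b, c, d}"
    using cut_connected_insert[OF _ _ assms(2)] by simp
  then show ?thesis
    using cut_connected_insert[OF _ _ assms(1)] by simp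
qed

text \<open>Serves both for the columns of one walk and for the walks that make up one branch
  set.\<close>

lemma cut_connected_UN_atLeastLessThan:
  fixes S :: "nat \<Rightarrow> 'a set"
  assumes "\<And>i. m \<le> i \<Longrightarrow> i < n \<Longrightarrow> cut_connected E (S i)"
    and "\<And>i. m \<le> i \<Longrightarrow> Suc i < n \<Longrightarrow> \<exists>x\<in>S i. \<exists>y\<in>S (Suc i). {x, y} \<in> E"
  shows "cut_connected E (\<Union>i\<in>{m..<n}. S i)"
  using assms
proof (induction n)
  case 0
  then show ?case by (simp add: cut_connected_def)
next
  case (Suc n)
  consider "n < m" | "n = m" | n' where "n = Suc n'" "m \<le> n'"
    by (metis Suc_le_D less_Suc_eq_le less_imp_Suc_add linorder_neqE_nat not_less_eq)
  then show ?case
  proof cases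
    case 1
    then show ?thesis by (simp add: cut_connected_def)
  next
    case 2
    then show ?thesis using Suc.prems(1)[of n] by simp
  next
    case 3
    obtain x y where xy: "x \<in> S n'" "y \<in> S n" "{x, y} \<in> E"
      using Suc.prems(2)[of n'] 3 by auto
    have "cut_connected E (\<Union>i\<in>{m..<n}. S i)"
      using Suc.IH Suc.prems by simp
    moreover have "cut_connected E (S n)"
      using Suc.prems(1)[of n] 3 by simp
    moreover have "x \<in> (\<Union>i\<in>{m..<n}. S i)"
      using 3 xy by auto
    ultimately have "cut_connected E ((\<Union>i\<in>{m..<n}. S i) \<union> S n)"
      using cut_connected_Un xy by metis
    moreover have "(\<Union>i\<in>{m..<Suc n}. S i) = (\<Union>i\<in>{m..<n}. S i) \<union> S n"
      using 3 by (simp add: atLeastLessThanSuc Un_commute)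
    ultimately show ?thesis by simp
  qed
qed

section \<open>From branch sets to minors\<close>

lemma minor_steps_delete_edges:
  assumes "finite D" "D \<subseteq> edges G"
  shows "minor_step\<^sup>*\<^sup>* G \<lparr>verts = verts G, edges = edges G - D\<rparr>"
  using assms
proof (induction D)
  case (insert e D)
  let ?G = "\<lparr>verts = verts G, edges = edges G - D\<rparr>"
  have "minor_step ?G (delete_edge ?G e)"
    using insert by (intro minor_step.delete_edge) auto
  moreover have "delete_edge ?G e = \<lparr>verts = verts G, edges = edges G - insert e D\<rparr>"
    by (auto simp: delete_edge_def)
  ultimately show ?case
    using insert by (metis insert_subset rtranclp.rtrancl_into_rtrancl)
qed (cases G, simp)

lemma is_minor_step:
  "minor_step G G' \<Longrightarrow> is_minor H G' \<Longrightarrow> is_minor H G"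
  unfolding is_minor_def by (meson converse_rtranclp_into_rtranclp)

lemma is_minor_spanning_subgraph:
  assumes G: "simple_graph G" and H: "simple_graph H" and \<phi>: "bij_betw \<phi> (verts H) (verts G)"
    and E: "\<And>u v. {u, v} \<in> edges H \<Longrightarrow> {\<phi> u, \<phi> v} \<in> edges G"
  shows "is_minor H G"
proof -
  have "finite (edges G)"
    using G finite_subset[of "edges G" "Pow (verts G)"] by (auto simp: simple_graph_def)
  define F where "F = image \<phi> ` edges H"
  have HE: "\<exists>u v. e = {u, v} \<and> u \<in> verts H \<and> v \<in> verts H" if "e \<in> edges H" for e
    using H that by (fastforce simp: simple_graph_def card_2_iff)
  have FE: "F \<subseteq> edges G"
    using E HE by (fastforce simp: F_def)
  then have "minor_step\<^sup>*\<^sup>* G \<lparr>verts = verts G, edges = F\<rparr>"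
    using minor_steps_delete_edges[of "edges G - F" G] \<open>finite (edges G)\<close>
    by (simp add: double_diff)
  moreover have "graph_isomorphic H \<lparr>verts = verts G, edges = F\<rparr>"
  proof -
    have "{u, v} \<in> edges H \<longleftrightarrow> {\<phi> u, \<phi> v} \<in> F" if uv: "u \<in> verts H" "v \<in> verts H" for u v
    proof
      assume "{u, v} \<in> edges H"
      then have "\<phi> ` {u, v} \<in> F" unfolding F_def by (rule imageI)
      then show "{\<phi> u, \<phi> v} \<in> F" by simp
    next
      assume "{\<phi> u, \<phi> v} \<in> F"
      then obtain e where e: "e \<in> edges H" "\<phi> ` e = \<phi> ` {u, v}" by (auto simp: F_def)
      moreover have "inj_on \<phi> (verts H)" "e \<subseteq> verts H"
        using \<phi> HE[OF e(1)] by (auto simp: bij_betw_def)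
      ultimately have "e = {u, v}"
        using inj_on_image_eq_iff[of \<phi> "verts H" e "{u, v}"] uv by simp
      with e show "{u, v} \<in> edges H" by simp
    qed
    with \<phi> show ?thesis by (auto simp: graph_isomorphic_def)
  qed
  ultimately show ?thesis by (auto simp: is_minor_def)
qed

text \<open>Induction on the number of vertices of \<open>G\<close>: delete a vertex outside all
  branch sets, or contract an edge inside a branch set with several vertices. If neither applies,
  the branch sets are singletons covering \<open>G\<close>, and \<open>H\<close> is a spanning
  subgraph up to isomorphism.\<close>

lemma is_minor_if_model:
  fixes G :: "'a ugraph" and H :: "'b ugraph"
  assumes "simple_graph G" and H: "simple_graph H"
    and "\<And>v. v \<in> verts H \<Longrightarrow> B v \<subseteq> verts G \<and> B v \<noteq> {} \<and> cut_connected (edges G) (B v)"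
    and "\<And>u v. u \<in> verts H \<Longrightarrow> v \<in> verts H \<Longrightarrow> u \<noteq> v \<Longrightarrow> B u \<inter> B v = {}"
    and "\<And>u v. {u, v} \<in> edges H \<Longrightarrow> \<exists>x\<in>B u. \<exists>y\<in>B v. {x, y} \<in> edges G"
  shows "is_minor H G"
  using assms(1,3-5)
proof (induction "card (verts G)" arbitrary: G B rule: less_induct)
  case less
  note G = less.prems(1) and B = less.prems(2) and disj = less.prems(3) and BE = less.prems(4)
  have fin: "finite (verts G)" using G by (simp add: simple_graph_def)
  have HE: "u \<in> verts H \<and> v \<in> verts H \<and> u \<noteq> v" if "{u, v} \<in> edges H" for u v
    using H that by (auto simp: simple_graph_def card_2_iff doubleton_eq_iff)
  consider z where "z \<in> verts G" "\<forall>v\<in>verts H. z \<notin> B v"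
    | w where "w \<in> verts H" "\<forall>x. B w \<noteq> {x}"
    | "\<forall>z\<in>verts G. \<exists>v\<in>verts H. z \<in> B v" "\<forall>v\<in>verts H. \<exists>x. B v = {x}"
    by blast
  then show ?case
  proof cases
    case 1
    let ?G = "delete_vertex G z"
    have st: "minor_step G ?G" using 1 by (intro minor_step.delete_vertex)
    have "is_minor H ?G"
    proof (rule less.hyps[of _ B])
      show "card (verts ?G) < card (verts G)"
        using card_Diff1_less[OF fin 1(1)] by (simp add: delete_vertex_def)
      show "simple_graph ?G" by (rule simple_graph_minor_step[OF st G])
      have e: "{x, y} \<in> edges ?G" if "{x, y} \<in> edges G" "x \<in> B u" "y \<in> B v" "u \<in> verts H" "v \<in> verts H" for x y u v
        using that 1 by (auto simp: delete_vertex_def)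
      show "B v \<subseteq> verts ?G \<and> B v \<noteq> {} \<and> cut_connected (edges ?G) (B v)" if v: "v \<in> verts H" for v
      proof -
        have "cut_connected (edges ?G) (B v)"
          using B[OF v] e[OF _ _ _ v v] unfolding cut_connected_def by (meson Diff_iff subsetD)
        then show ?thesis using B[OF v] v 1 by (auto simp: delete_vertex_def)
      qed
      show "\<exists>x\<in>B u. \<exists>y\<in>B v. {x, y} \<in> edges ?G" if "{u, v} \<in> edges H" for u v
        using BE[OF that] HE[OF that] e by blast
    qed (use disj in blast)
    then show ?thesis using st is_minor_step by blast
  next
    case 2
    obtain p where p: "p \<in> B w" using B[OF 2(1)] by blast
    \<comment> \<open>Since \<open>B w\<close> is not a singleton, connectedness across the cut
      \<open>{p}\<close> supplies an edge inside it.\<close>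
    then obtain a b where ab: "a \<in> B w" "b \<in> B w" "a \<noteq> b" "{a, b} \<in> edges G"
      using B[OF 2(1)] 2(2) unfolding cut_connected_def
      by (metis (no_types, lifting) DiffE empty_subsetI insert_not_empty insert_subset singletonD)
    let ?G = "contract_edge G a b"
    define f where "f = (\<lambda>z. if z = b then a else z)"
    define B' where "B' = (\<lambda>v. if v = w then B w - {b} else B v)"
    have st: "minor_step G ?G" using ab by (intro minor_step.contract_edge)
    have abG: "a \<in> verts G" "b \<in> verts G" using ab B[OF 2(1)] by auto
    have e: "{f x, f y} \<in> edges ?G" if "{x, y} \<in> edges G" "{x, y} \<noteq> {a, b}" for x y
    proof -
      have "f ` {x, y} \<in> edges ?G"
        using that unfolding contract_edge_def f_def ugraph.simps by blast
      then show ?thesis by simp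
    qed
    have bB: "b \<notin> B v" if "v \<in> verts H" "v \<noteq> w" for v
      using disj[OF that(1) 2(1) that(2)] ab by blast
    have fB: "f x \<in> B' v" if "x \<in> B v" "v \<in> verts H" for x v
      using that ab bB by (auto simp: f_def B'_def)
    have sub: "B' v \<subseteq> B v" for v by (auto simp: B'_def)
    have "is_minor H ?G"
    proof (rule less.hyps[of _ B'])
      show "card (verts ?G) < card (verts G)"
        using card_Diff1_less[OF fin abG(2)] by (simp add: contract_edge_def)
      show "simple_graph ?G" by (rule simple_graph_minor_step[OF st G])
      show "B' u \<inter> B' v = {}" if "u \<in> verts H" "v \<in> verts H" "u \<noteq> v" for u v
        using disj[OF that] sub by blast
      show "B' v \<subseteq> verts ?G \<and> B' v \<noteq> {} \<and> cut_connected (edges ?G) (B' v)" if v: "v \<in> verts H" for v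
      proof -
        have "B' v \<subseteq> verts G - {b}" using B[OF v] bB[OF v] by (auto simp: B'_def)
        moreover have "B' v \<noteq> {}" using B[OF v] fB v by blast
        moreover have "cut_connected (edges ?G) (B' v)"
          unfolding cut_connected_def
        proof (intro allI impI)
          fix X assume X: "X \<subseteq> B' v" "X \<noteq> {}" "X \<noteq> B' v"
          \<comment> \<open>A cut of the contracted branch set is pulled back along
            \<open>f\<close>. The crossing edge found there is not the contracted one, because
            \<open>f\<close> identifies \<open>a\<close> and \<open>b\<close> and so puts them on
            the same side.\<close>
          define Y where "Y = {y \<in> B v. f y \<in> X}"
          have fX: "f z = z" if "z \<in> B' v" for z
            using that bB[OF v] by (auto simp: f_def B'_def split: if_splits)
          have "X \<subseteq> Y" using X sub fX by (auto simp: Y_def)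
          moreover have "B' v - X \<subseteq> B v - Y" using sub fX by (auto simp: Y_def)
          ultimately have "Y \<subseteq> B v" "Y \<noteq> {}" "Y \<noteq> B v" using X by (auto simp: Y_def)
          then obtain x y where xy: "x \<in> Y" "y \<in> B v - Y" "{x, y} \<in> edges G"
            using B[OF v] unfolding cut_connected_def by meson
          then have fxy: "f x \<in> X" "f y \<in> B' v - X" using fB v by (auto simp: Y_def)
          moreover have "f a = f b" by (simp add: f_def)
          ultimately have "{x, y} \<noteq> {a, b}" by (auto simp: doubleton_eq_iff)
          with e xy fxy show "\<exists>x\<in>X. \<exists>y\<in>B' v - X. {x, y} \<in> edges ?G" by blast
        qed
        ultimately show ?thesis by (simp add: contract_edge_def)
      qed
      show "\<exists>x\<in>B' u. \<exists>y\<in>B' v. {x, y} \<in> edges ?G" if uv: "{u, v} \<in> edges H" for u v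
      proof -
        obtain x y where xy: "x \<in> B u" "y \<in> B v" "{x, y} \<in> edges G" using BE[OF uv] by blast
        note h = HE[OF uv]
        have "{x, y} \<noteq> {a, b}"
        proof
          assume "{x, y} = {a, b}"
          then have "x \<in> B w" "y \<in> B w" using ab by (auto simp: doubleton_eq_iff)
          then show False using disj[of u w] disj[of v w] h xy 2(1) by blast
        qed
        with e xy fB h show ?thesis by blast
      qed
    qed
    then show ?thesis using st is_minor_step by blast
  next
    case 3
    then obtain \<phi> where \<phi>: "\<And>v. v \<in> verts H \<Longrightarrow> B v = {\<phi> v}" by metis
    have "bij_betw \<phi> (verts H) (verts G)"
      unfolding bij_betw_def
    proof
      show "inj_on \<phi> (verts H)"
      proof (rule inj_onI, rule ccontr)
        fix u v assume "u \<in> verts H" "v \<in> verts H" "\<phi> u = \<phi> v" "u \<noteq> v"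
        then show False using disj[of u v] \<phi> by simp
      qed
      show "\<phi> ` verts H = verts G" using 3(1) \<phi> B by fastforce
    qed
    then show ?thesis
    proof (rule is_minor_spanning_subgraph[OF G H])
      fix u v assume "{u, v} \<in> edges H"
      from BE[OF this] HE[OF this] \<phi> show "{\<phi> u, \<phi> v} \<in> edges G" by auto
    qed
  qed
qed

section \<open>The lower bound\<close>

text \<open>Each round is played in its own column of \<open>Q_l\<close>, so that only tokens within
  one round can collide, and \<open>Q_2\<close> keeps these apart. The suffixes \<open>a\<close> and
  \<open>b\<close> do not depend on \<open>x\<close>, so neighbouring positions have neighbouring
  endpoints at both ends of the walks.\<close>

lemma hypercube_disjoint_routing:
  assumes \<pi>: "bij_betw \<pi> (cube k) (cube k)" and k: "k \<ge> 1" and l: "2 * k \<le> 2 ^ l"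
  obtains S a b where
    "length a = 2 + l" "length b = 2 + l"
    "\<And>x. x \<in> cube k \<Longrightarrow> S x \<subseteq> cube (k + 2 + l)"
    "\<And>x. x \<in> cube k \<Longrightarrow> cut_connected (edges (hypercube (k + 2 + l))) (S x)"
    "\<And>x. x \<in> cube k \<Longrightarrow> x @ a \<in> S x \<and> \<pi> x @ b \<in> S x"
    "\<And>x y. x \<in> cube k \<Longrightarrow> y \<in> cube k \<Longrightarrow> x \<noteq> y \<Longrightarrow> S x \<inter> S y = {}"
proof -
  let ?E = "edges (hypercube (k + 2 + l))"
  obtain \<sigma> where "routes k \<sigma> \<pi>" using exists_routes[OF \<pi>] by blast
  then have inj: "\<And>t x y. t \<le> 2 * k \<Longrightarrow> x \<in> cube k \<Longrightarrow> y \<in> cube k \<Longrightarrow> \<sigma> t x = \<sigma> t y \<Longrightarrow> x = y"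
    and C: "\<And>t x. t \<le> 2 * k \<Longrightarrow> x \<in> cube k \<Longrightarrow> length (\<sigma> t x) = k"
    and ends: "\<And>x. x \<in> cube k \<Longrightarrow> \<sigma> 0 x = x" "\<And>x. x \<in> cube k \<Longrightarrow> \<sigma> (2 * k) x = \<pi> x"
    and step: "\<And>t x. t < 2 * k \<Longrightarrow> x \<in> cube k \<Longrightarrow> \<sigma> (Suc t) x = \<sigma> t x \<or> adj (\<sigma> t x) (\<sigma> (Suc t) x)"
    unfolding routes_def inj_on_def cube_def by blast+
  \<comment> \<open>In round \<open>t\<close>, which takes place in column \<open>t\<close>, a token enters at \<open>port t\<close>, crosses at the middle vertex
    of \<open>Q_2\<close> given by the parity of its position, and leaves at \<open>port (Suc t)\<close>. Since a move changes the
    parity, no two tokens visit the same vertex.\<close>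
  define port where "port = (\<lambda>t :: nat. [odd t, odd t])"
  define mid where "mid = (\<lambda>w. [even (weight w), odd (weight w)])"
  define vx where "vx = (\<lambda>w q t. w @ q @ gray l t)"
  define P where "P = (\<lambda>t x. {vx (\<sigma> t x) (port t) t, vx (\<sigma> t x) (mid (\<sigma> t x)) t,
      vx (\<sigma> (Suc t) x) (mid (\<sigma> t x)) t, vx (\<sigma> (Suc t) x) (port (Suc t)) t})"
  define S where "S = (\<lambda>x. \<Union>t\<in>{0..<2 * k}. P t x)"
  have len: "length (port t) = 2" "length (mid w) = 2" for t w
    by (auto simp: port_def mid_def)
  have q_edge: "{vx w q t, vx w q' t} \<in> ?E"
    if "length w = k" "adj q q'" "length q = 2" for w q q' t
    using that adj_length[OF that(2)]
    by (auto simp: edge_hypercube_iff vx_def intro!: adj_append_left adj_append_right)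
  have port_mid: "adj (port t) (mid w)" "adj (mid w) (port t)" for t w
    unfolding port_def mid_def
    by (cases "odd t"; cases "odd (weight w)"; force intro: adj_flip_hd adj_Cons)+
  have conn: "cut_connected ?E (P t x)" if t: "t < 2 * k" and x: "x \<in> cube k" for t x
  proof -
    have l: "length (\<sigma> t x) = k" "length (\<sigma> (Suc t) x) = k" using C t x by auto
    have "vx (\<sigma> t x) (mid (\<sigma> t x)) t = vx (\<sigma> (Suc t) x) (mid (\<sigma> t x)) t \<or>
        {vx (\<sigma> t x) (mid (\<sigma> t x)) t, vx (\<sigma> (Suc t) x) (mid (\<sigma> t x)) t} \<in> ?E"
      using step[OF t x] l len
      by (auto simp: edge_hypercube_iff vx_def intro!: adj_append_right)
    then show ?thesis
      unfolding P_def using q_edge[OF l(1) port_mid(1)] q_edge[OF l(2) port_mid(2)] len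
      by (intro cut_connected_path4) simp_all
  qed
  have link: "\<exists>u\<in>P t x. \<exists>v\<in>P (Suc t) x. {u, v} \<in> ?E" if t: "Suc t < 2 * k" and x: "x \<in> cube k" for t x
  proof -
    have "length (\<sigma> (Suc t) x) = k" using C t x by auto
    moreover have "adj (gray l t) (gray l (Suc t))" using t l by (intro adj_gray_Suc) simp
    ultimately have "{vx (\<sigma> (Suc t) x) (port (Suc t)) t, vx (\<sigma> (Suc t) x) (port (Suc t)) (Suc t)} \<in> ?E"
      using len by (auto simp: edge_hypercube_iff vx_def intro!: adj_append_left)
    then show ?thesis unfolding P_def by blast
  qed
  have PC: "P t x \<subseteq> cube (k + 2 + l)" if "t < 2 * k" "x \<in> cube k" for t x
    using that C[of t x] C[of "Suc t" x] len by (auto simp: P_def vx_def cube_def)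
  have disj: "P s x \<inter> P t y = {}" if s: "s < 2 * k" and t: "t < 2 * k" and x: "x \<in> cube k" and y: "y \<in> cube k"
    and xy: "x \<noteq> y" for s t x y
  proof (rule ccontr)
    assume "P s x \<inter> P t y \<noteq> {}"
    then obtain z where z: "z \<in> P s x" "z \<in> P t y" by blast
    have lens: "length (\<sigma> s x) = k" "length (\<sigma> (Suc s) x) = k" "length (\<sigma> t y) = k" "length (\<sigma> (Suc t) y) = k"
      using C s t x y by auto
    have eq: "w = w' \<and> q = q' \<and> s = t"
      if "vx w q s = vx w' q' t" "length w = k" "length w' = k" "length q = 2" "length q' = 2" for w w' q q'
    proof -
      have "w = w'" "q = q'" "gray l s = gray l t" using that by (auto simp: vx_def)
      moreover have "s = t"
        using inj_onD[OF inj_on_gray[of l] \<open>gray l s = gray l t\<close>] s t l by simp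
      ultimately show ?thesis by simp
    qed
    obtain w q w' q' where wq: "z = vx w q s" "z = vx w' q' t"
      and 1: "w = \<sigma> s x \<and> q = port s \<or> w = \<sigma> s x \<and> q = mid (\<sigma> s x) \<or>
        w = \<sigma> (Suc s) x \<and> q = mid (\<sigma> s x) \<or> w = \<sigma> (Suc s) x \<and> q = port (Suc s)"
      and 2: "w' = \<sigma> t y \<and> q' = port t \<or> w' = \<sigma> t y \<and> q' = mid (\<sigma> t y) \<or>
        w' = \<sigma> (Suc t) y \<and> q' = mid (\<sigma> t y) \<or> w' = \<sigma> (Suc t) y \<and> q' = port (Suc t)"
      using z unfolding P_def by blast
    have "w = w' \<and> q = q' \<and> s = t"
      by (rule eq) (use wq 1 2 lens len in auto)
    then have st: "s = t" "w' = w" "q' = q" by auto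
    \<comment> \<open>\<open>port t\<close>, \<open>port (Suc t)\<close> and every
      \<open>mid v\<close> differ pairwise, so only visits of the same kind can clash. Entries and
      exits are separated by injectivity; at the middle vertices the remaining case, one token
      arriving where the other departs, is excluded by \<open>par\<close>.\<close>
    have ne: "port t \<noteq> mid v" "mid v \<noteq> port t" "port t \<noteq> port (Suc t)" "port (Suc t) \<noteq> port t"
      "port (Suc t) \<noteq> mid v" "mid v \<noteq> port (Suc t)" for t v
      by (auto simp: port_def mid_def)
    have i: "\<sigma> t x \<noteq> \<sigma> t y" "\<sigma> (Suc t) x \<noteq> \<sigma> (Suc t) y"
      using inj[of t x y] inj[of "Suc t" x y] t x y xy by auto
    have par: "\<sigma> (Suc t) x \<noteq> \<sigma> t y" if m: "mid (\<sigma> t x) = mid (\<sigma> t y)" "x \<in> cube k" "\<sigma> t x \<noteq> \<sigma> t y" for x y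
    proof
      assume e: "\<sigma> (Suc t) x = \<sigma> t y"
      then have "adj (\<sigma> t x) (\<sigma> t y)" using step[OF t m(2)] m(3) by auto
      then show False using weight_adj m(1) by (fastforce simp: mid_def)
    qed
    show False
      using 1 2 st ne i par[of x y] par[of y x] x y by metis
  qed
  show thesis
  \<comment> \<open>Round \<open>2 * k - 1\<close> is the last one and is left through
    \<open>port (2 * k)\<close>; \<open>k \<ge> 1\<close> guarantees that there is a round at
    all.\<close>
  proof (rule that[of "port 0 @ gray l 0" "port (2 * k) @ gray l (2 * k - 1)" S])
    fix x assume x: "x \<in> cube k"
    show "S x \<subseteq> cube (k + 2 + l)"
      unfolding S_def by (rule UN_least) (use PC x in simp)
    show "cut_connected ?E (S x)"
      unfolding S_def by (rule cut_connected_UN_atLeastLessThan) (use conn link x in auto)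
    have "x @ port 0 @ gray l 0 \<in> P 0 x" using ends(1)[OF x] by (simp add: P_def vx_def)
    moreover have "\<pi> x @ port (2 * k) @ gray l (2 * k - 1) \<in> P (2 * k - 1) x"
      using ends(2)[OF x] k by (simp add: P_def vx_def)
    ultimately show "x @ port 0 @ gray l 0 \<in> S x \<and> \<pi> x @ port (2 * k) @ gray l (2 * k - 1) \<in> S x"
      unfolding S_def using k by (force intro: bexI[of _ "2 * k - 1"])
  next
    fix x y assume "x \<in> cube k" "y \<in> cube k" "x \<noteq> y"
    then show "S x \<inter> S y = {}" using disj by (fastforce simp: S_def)
  qed (auto simp: len)
qed

section \<open>Half-edges and their routing\<close>

text \<open>The complements of the two images have the same size and can be matched
  arbitrarily.\<close>

lemma extend_to_bij:
  assumes fin: "finite X" and P: "inj_on P D" "P ` D \<subseteq> X" and Q: "inj_on Q D" "Q ` D \<subseteq> X"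
  obtains \<pi> where "bij_betw \<pi> X X" "\<And>\<delta>. \<delta> \<in> D \<Longrightarrow> \<pi> (P \<delta>) = Q \<delta>"
proof -
  have "card (X - P ` D) = card (X - Q ` D)"
    using fin P Q by (simp add: card_Diff_subset finite_subset card_image)
  then obtain h where h: "bij_betw h (X - P ` D) (X - Q ` D)"
    using fin by (metis finite_Diff finite_same_card_bij)
  define \<pi> where "\<pi> = (\<lambda>x. if x \<in> P ` D then Q (inv_into D P x) else h x)"
  have e: "\<pi> (P \<delta>) = Q \<delta>" if "\<delta> \<in> D" for \<delta>
    using that P by (simp add: \<pi>_def)
  have "bij_betw \<pi> (P ` D) (Q ` D)"
    unfolding bij_betw_def
  proof
    show "inj_on \<pi> (P ` D)"
      by (rule inj_onI) (use e Q(1) in \<open>auto dest: inj_onD\<close>)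
    show "\<pi> ` P ` D = Q ` D" using e by (auto simp: image_image)
  qed
  moreover have "bij_betw \<pi> (X - P ` D) (X - Q ` D)"
    using h by (rule bij_betw_cong[THEN iffD1, rotated]) (simp add: \<pi>_def)
  ultimately have "bij_betw \<pi> (P ` D \<union> (X - P ` D)) (Q ` D \<union> (X - Q ` D))"
    by (rule bij_betw_combine) auto
  moreover have "P ` D \<union> (X - P ` D) = X" "Q ` D \<union> (X - Q ` D) = X" using P Q by auto
  ultimately show thesis using that e by metis
qed

text \<open>A dart is an edge together with one of its ends. In increasing order of the vertices,
  each \<open>v\<close> receives a block of as many positions as its degree, starting at the degree
  sum of the smaller vertices; the handshake identity bounds the total.\<close>

lemma dart_enumeration:
  fixes H :: "nat ugraph"
  assumes H: "simple_graph H"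
  obtains lo hi :: "nat \<Rightarrow> nat" and pos where
    "\<And>v e. v \<in> verts H \<Longrightarrow> e \<in> edges H \<Longrightarrow> v \<in> e \<Longrightarrow> lo v \<le> pos v e \<and> pos v e < hi v"
    "\<And>v e e'. v \<in> verts H \<Longrightarrow> e \<in> edges H \<Longrightarrow> v \<in> e \<Longrightarrow> e' \<in> edges H \<Longrightarrow> v \<in> e' \<Longrightarrow>
      pos v e = pos v e' \<Longrightarrow> e = e'"
    "\<And>v. v \<in> verts H \<Longrightarrow> hi v \<le> 2 * card (edges H)"
    "\<And>u v. u \<in> verts H \<Longrightarrow> v \<in> verts H \<Longrightarrow> u \<noteq> v \<Longrightarrow> {lo u..<hi u} \<inter> {lo v..<hi v} = {}"
proof -
  have fin: "finite (verts H)" and E: "\<And>e. e \<in> edges H \<Longrightarrow> e \<subseteq> verts H \<and> card e = 2"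
    using H by (auto simp: simple_graph_def)
  have finE: "finite (edges H)"
    using fin E finite_subset[of "edges H" "Pow (verts H)"] by auto
  define inc where "inc = (\<lambda>v. {e. e \<in> edges H \<and> v \<in> e})"
  define lo where "lo = (\<lambda>v. \<Sum>u\<in>{u \<in> verts H. u < v}. card (inc u))"
  define hi where "hi = (\<lambda>v. lo v + card (inc v))"
  have "\<forall>v. \<exists>h. bij_betw h (inc v) {0..<card (inc v)}"
    using finE by (auto simp: inc_def intro!: ex_bij_betw_finite_nat)
  then obtain h where hb: "\<And>v. bij_betw (h v) (inc v) {0..<card (inc v)}"
    by metis
  have hi_sum: "hi v = (\<Sum>u\<in>{u \<in> verts H. u \<le> v}. card (inc u))" if "v \<in> verts H" for v
  proof -
    have "{u \<in> verts H. u \<le> v} = insert v {u \<in> verts H. u < v}" using that by auto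
    then show ?thesis using fin by (simp add: hi_def lo_def)
  qed
  have total: "(\<Sum>u\<in>verts H. card (inc u)) = 2 * card (edges H)"
  proof -
    have "(\<Sum>u\<in>verts H. card (inc u)) = (\<Sum>u\<in>verts H. \<Sum>e | e \<in> edges H \<and> u \<in> e. 1)"
      by (simp add: inc_def)
    also have "\<dots> = (\<Sum>e\<in>edges H. \<Sum>u | u \<in> verts H \<and> u \<in> e. 1)"
      by (rule sum.swap_restrict[OF fin finE])
    also have "\<dots> = (\<Sum>e\<in>edges H. 2)"
    proof (rule sum.cong[OF refl])
      fix e assume "e \<in> edges H"
      then have "{u. u \<in> verts H \<and> u \<in> e} = e" "card e = 2" using E by auto
      then show "(\<Sum>u | u \<in> verts H \<and> u \<in> e. 1) = (2 :: nat)" by simp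
    qed
    finally show ?thesis by simp
  qed
  show thesis
  proof (rule that[of lo "\<lambda>v e. lo v + h v e" hi])
    fix v e assume "v \<in> verts H" "e \<in> edges H" "v \<in> e"
    then have "h v e \<in> {0..<card (inc v)}"
      using hb[of v] by (auto simp: bij_betw_def inc_def)
    then show "lo v \<le> lo v + h v e \<and> lo v + h v e < hi v" by (simp add: hi_def)
  next
    fix v e e' assume "e \<in> edges H" "v \<in> e" "e' \<in> edges H" "v \<in> e'" "lo v + h v e = lo v + h v e'"
    then show "e = e'" using hb[of v] by (auto simp: bij_betw_def inc_def inj_on_def)
  next
    fix v assume v: "v \<in> verts H"
    have "hi v \<le> (\<Sum>u\<in>verts H. card (inc u))"
      unfolding hi_sum[OF v] using fin by (intro sum_mono2) auto
    then show "hi v \<le> 2 * card (edges H)" using total by simp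
  next
    have le: "hi u \<le> lo v" if "u \<in> verts H" "u < v" for u v
      unfolding hi_sum[OF that(1)] lo_def using fin that by (intro sum_mono2) auto
    fix u v assume "u \<in> verts H" "v \<in> verts H" "u \<noteq> v"
    then show "{lo u..<hi u} \<inter> {lo v..<hi v} = {}"
      using le[of u v] le[of v u] by (cases "u < v") auto
  qed
qed

text \<open>Branch sets are connected at the starting ends of the walks and joined to each other at
  the final ends: consecutive Gray code positions are adjacent, and the permutation brings the two
  darts of an edge to consecutive positions.\<close>

lemma is_minor_hypercube:
  fixes H :: "nat ugraph"
  assumes H: "simple_graph H" and iso: "no_isolated_vertices H"
    and m: "2 * card (edges H) \<le> 2 ^ k" and k: "k \<ge> 1" and l: "2 * k \<le> 2 ^ l"
  shows "is_minor H (hypercube (k + 2 + l))"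
proof -
  let ?G = "hypercube (k + 2 + l)"
  have fin: "finite (verts H)" and E: "\<And>e. e \<in> edges H \<Longrightarrow> e \<subseteq> verts H \<and> card e = 2"
    using H by (auto simp: simple_graph_def)
  have finE: "finite (edges H)"
    using fin E finite_subset[of "edges H" "Pow (verts H)"] by auto
  obtain lo hi :: "nat \<Rightarrow> nat" and pos where
    pos: "\<And>v e. v \<in> verts H \<Longrightarrow> e \<in> edges H \<Longrightarrow> v \<in> e \<Longrightarrow> lo v \<le> pos v e \<and> pos v e < hi v"
    and pos_inj: "\<And>v e e'. v \<in> verts H \<Longrightarrow> e \<in> edges H \<Longrightarrow> v \<in> e \<Longrightarrow> e' \<in> edges H \<Longrightarrow> v \<in> e' \<Longrightarrow>
      pos v e = pos v e' \<Longrightarrow> e = e'"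
    and hi: "\<And>v. v \<in> verts H \<Longrightarrow> hi v \<le> 2 * card (edges H)"
    and lohi: "\<And>u v. u \<in> verts H \<Longrightarrow> v \<in> verts H \<Longrightarrow> u \<noteq> v \<Longrightarrow> {lo u..<hi u} \<inter> {lo v..<hi v} = {}"
    by (rule dart_enumeration[OF H]) (rule that)
  obtain num where num: "bij_betw num (edges H) {0..<card (edges H)}"
    using ex_bij_betw_finite_nat[OF finE] by blast
  define D where "D = {(v, e). e \<in> edges H \<and> v \<in> e}"
  have DV: "v \<in> verts H" "e \<in> edges H" "v \<in> e" if "(v, e) \<in> D" for v e
    using that E by (auto simp: D_def)
  define p where "p = (\<lambda>(v, e). pos v e)"
  \<comment> \<open>The targets of the two darts of \<open>e\<close> are \<open>2 * num e\<close>
    and \<open>2 * num e + 1\<close>, the smaller end of \<open>e\<close> coming first.\<close>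
  define q where "q = (\<lambda>(v, e). 2 * num e + (if v = Min e then 0 else 1))"
  have gray_inj: "i = j" if "gray k i = gray k j" "i < 2 ^ k" "j < 2 ^ k" for i j
    using inj_on_gray[of k] that by (auto simp: inj_on_def)
  have p_lt: "p \<delta> < 2 ^ k" if "\<delta> \<in> D" for \<delta>
  proof -
    obtain v e where \<delta>: "\<delta> = (v, e)" by fastforce
    from DV[of v e] that pos[of v e] hi[of v] m show ?thesis by (simp add: \<delta> p_def)
  qed
  have q_lt: "q \<delta> < 2 ^ k" if "\<delta> \<in> D" for \<delta>
  proof -
    obtain v e where \<delta>: "\<delta> = (v, e)" by fastforce
    have "num e < card (edges H)"
      using DV[of v e] that num by (auto simp: \<delta> bij_betw_def)
    then show ?thesis using m by (simp add: \<delta> q_def)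
  qed
  have p_inj: "\<delta> = \<epsilon>" if d: "\<delta> \<in> D" "\<epsilon> \<in> D" "p \<delta> = p \<epsilon>" for \<delta> \<epsilon>
  proof -
    obtain v e v' e' where \<delta>: "\<delta> = (v, e)" "\<epsilon> = (v', e')" by fastforce
    have "v = v'"
    proof (rule ccontr)
      assume "v \<noteq> v'"
      then have "{lo v..<hi v} \<inter> {lo v'..<hi v'} = {}"
        using lohi DV d \<delta> by blast
      moreover have "p \<delta> \<in> {lo v..<hi v}" "p \<epsilon> \<in> {lo v'..<hi v'}"
        using pos[of v e] pos[of v' e'] DV[of v e] DV[of v' e'] d(1,2) \<delta> by (simp_all add: p_def)
      ultimately show False using d(3) by auto
    qed
    moreover have "e = e'"
      using pos_inj[of v e e'] DV d \<delta> \<open>v = v'\<close> by (auto simp: p_def)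
    ultimately show ?thesis using \<delta> by simp
  qed
  have q_inj: "\<delta> = \<epsilon>" if d: "\<delta> \<in> D" "\<epsilon> \<in> D" "q \<delta> = q \<epsilon>" for \<delta> \<epsilon>
  proof -
    obtain v e v' e' where \<delta>: "\<delta> = (v, e)" "\<epsilon> = (v', e')" by fastforce
    have "num e = num e'" and M: "v = Min e \<longleftrightarrow> v' = Min e'"
      using d(3) unfolding \<delta> q_def by (auto split: if_splits) presburger+
    then have "e = e'"
      using num DV d \<delta> by (auto simp: bij_betw_def inj_on_def)
    moreover have "v = v'"
    proof -
      obtain x y where xy: "e = {x, y}" "x \<noteq> y"
        using E DV d \<delta> by (metis card_2_iff)
      then show ?thesis
        using M DV[of v e] DV[of v' e'] d \<delta> \<open>e = e'\<close> by (auto simp: min_def split: if_splits)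
    qed
    ultimately show ?thesis using \<delta> by simp
  qed
  obtain \<pi> where \<pi>: "bij_betw \<pi> (cube k) (cube k)"
    and \<pi>D: "\<And>\<delta>. \<delta> \<in> D \<Longrightarrow> \<pi> (gray k (p \<delta>)) = gray k (q \<delta>)"
  proof (rule extend_to_bij[OF finite_cube])
    show "inj_on (\<lambda>\<delta>. gray k (p \<delta>)) D"
      by (rule inj_onI) (use gray_inj p_lt p_inj in blast)
    show "inj_on (\<lambda>\<delta>. gray k (q \<delta>)) D"
      by (rule inj_onI) (use gray_inj q_lt q_inj in blast)
  qed (auto simp: cube_def)
  have gC: "gray k i \<in> cube k" for i by (simp add: cube_def)
  obtain S a b where len: "length a = 2 + l" "length b = 2 + l"
    and SC: "\<And>x. x \<in> cube k \<Longrightarrow> S x \<subseteq> cube (k + 2 + l)"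
    and Sconn: "\<And>x. x \<in> cube k \<Longrightarrow> cut_connected (edges ?G) (S x)"
    and Sab: "\<And>x. x \<in> cube k \<Longrightarrow> x @ a \<in> S x \<and> \<pi> x @ b \<in> S x"
    and Sdisj: "\<And>x y. x \<in> cube k \<Longrightarrow> y \<in> cube k \<Longrightarrow> x \<noteq> y \<Longrightarrow> S x \<inter> S y = {}"
    by (rule hypercube_disjoint_routing[OF \<pi> k l]) (rule that)
  define B where "B = (\<lambda>v. \<Union>i\<in>{lo v..<hi v}. S (gray k i))"
  have SB: "S (gray k (p (v, e))) \<subseteq> B v" if "(v, e) \<in> D" for v e
    using pos[OF DV[OF that]] by (auto simp: B_def p_def)
  show ?thesis
  proof (rule is_minor_if_model[OF simple_graph_hypercube H, of B])
    fix v assume v: "v \<in> verts H"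
    have lt: "i < 2 ^ k" if "i < hi v" for i using hi[OF v] m that by simp
    have "cut_connected (edges ?G) (B v)"
      unfolding B_def
    proof (rule cut_connected_UN_atLeastLessThan)
      fix i assume "Suc i < hi v"
      then have "adj (gray k i @ a) (gray k (Suc i) @ a)"
        using lt by (intro adj_append_right adj_gray_Suc) simp
      then have "{gray k i @ a, gray k (Suc i) @ a} \<in> edges ?G"
        using len by (simp add: edge_hypercube_iff)
      then show "\<exists>x\<in>S (gray k i). \<exists>y\<in>S (gray k (Suc i)). {x, y} \<in> edges ?G"
        using Sab gC by blast
    qed (use Sconn gC in blast)
    \<comment> \<open>Every vertex has a dart because none is isolated, so its block of positions is
      nonempty.\<close>
    moreover obtain e where "(v, e) \<in> D"
      using iso v by (auto simp: no_isolated_vertices_def D_def)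
    then have "B v \<noteq> {}" using SB Sab gC by blast
    moreover have "B v \<subseteq> verts ?G" using SC gC by (auto simp: B_def verts_hypercube)
    ultimately show "B v \<subseteq> verts ?G \<and> B v \<noteq> {} \<and> cut_connected (edges ?G) (B v)" by blast
  next
    fix u v assume uv: "u \<in> verts H" "v \<in> verts H" "u \<noteq> v"
    have "S (gray k i) \<inter> S (gray k j) = {}" if ij: "i \<in> {lo u..<hi u}" "j \<in> {lo v..<hi v}" for i j
    proof -
      have "i \<noteq> j" using lohi[OF uv] ij by blast
      moreover have "i < 2 ^ k" "j < 2 ^ k" using ij hi uv m by fastforce+
      ultimately have "gray k i \<noteq> gray k j" using gray_inj by blast
      then show ?thesis using Sdisj gC by blast
    qed
    then show "B u \<inter> B v = {}" unfolding B_def by blast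
  next
    fix u v assume uv: "{u, v} \<in> edges H"
    have *: "\<exists>x\<in>B u. \<exists>y\<in>B v. {x, y} \<in> edges ?G" if uv: "{u, v} \<in> edges H" "u < v" for u v
    proof -
      let ?e = "{u, v}"
      have D: "(u, ?e) \<in> D" "(v, ?e) \<in> D" using uv by (auto simp: D_def)
      have "Min ?e = u" using uv by simp
      then have q: "q (v, ?e) = Suc (q (u, ?e))" using uv by (simp add: q_def)
      then have "adj (gray k (q (u, ?e)) @ b) (gray k (q (v, ?e)) @ b)"
        using q_lt[OF D(2)] by (auto intro!: adj_append_right adj_gray_Suc)
      then have "{gray k (q (u, ?e)) @ b, gray k (q (v, ?e)) @ b} \<in> edges ?G"
        using len by (simp add: edge_hypercube_iff)
      moreover have "gray k (q (w, ?e)) @ b \<in> B w" if "(w, ?e) \<in> D" for w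
        using Sab[OF gC, of "p (w, ?e)"] \<pi>D[OF that] SB[OF that] by auto
      ultimately show ?thesis using D by blast
    qed
    have "u \<noteq> v" using E[OF uv] by auto
    then consider "u < v" | "v < u" by linarith
    then show "\<exists>x\<in>B u. \<exists>y\<in>B v. {x, y} \<in> edges ?G"
    proof cases
      case 1
      then show ?thesis using * uv by blast
    next
      case 2
      then have "\<exists>x\<in>B v. \<exists>y\<in>B u. {x, y} \<in> edges ?G" using *[of v u] uv by (simp add: insert_commute)
      then show ?thesis by (metis insert_commute)
    qed
  qed
qed

text \<open>Settles the case of no edges, the only one that arises when the edge bound is below
  1.\<close>

lemma is_minor_empty_graph:
  assumes "simple_graph G" "verts H = {}" "edges H = {}"
  shows "is_minor H G"
  by (rule is_minor_if_model) (use assms in \<open>auto simp: simple_graph_def\<close>)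

text \<open>The least \<open>l\<close> with \<open>2 * d \<le> 2 ^ l\<close> has
  \<open>2 ^ l < 4 * d\<close>, so \<open>Q_2\<close> and \<open>Q_l\<close> together cost a factor
  below \<open>16 * d\<close>, and the two darts per edge cost a further 2; hence 1/32.\<close>

lemma hypercube_universal:
  assumes d: "d \<ge> 1"
  shows "minor_universal (1 / 32 * 2 ^ d / real d) (hypercube d)"
  unfolding minor_universal_def
proof (intro allI impI, elim conjE)
  fix H :: "nat ugraph"
  assume H: "simple_graph H" "no_isolated_vertices H" "real (card (edges H)) \<le> 1 / 32 * 2 ^ d / real d"
  have finE: "finite (edges H)"
    using H(1) finite_subset[of "edges H" "Pow (verts H)"] by (auto simp: simple_graph_def)
  show "is_minor H (hypercube d)"
  proof (cases "edges H = {}")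
    case True
    then have "verts H = {}" using H(2) by (auto simp: no_isolated_vertices_def)
    then show ?thesis using True is_minor_empty_graph simple_graph_hypercube by blast
  next
    case False
    let ?m = "card (edges H)"
    have m1: "?m \<ge> 1" using False finE by (simp add: Suc_le_eq card_gt_0_iff)
    have "real (32 * d * ?m) \<le> real (2 ^ d)"
      using H(3) d by (simp add: field_simps)
    then have m: "32 * d * ?m \<le> 2 ^ d" by (simp only: of_nat_le_iff)
    define l where "l = (LEAST l. 2 * d \<le> 2 ^ l)"
    have ex: "2 * d \<le> 2 ^ (2 * d)" by (simp add: less_imp_le)
    then have l: "2 * d \<le> 2 ^ l" unfolding l_def by (rule LeastI)
    have "l \<noteq> 0" using l d by (cases l) auto
    then obtain l' where l': "l = Suc l'" using not0_implies_Suc by blast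
    have "\<not> 2 * d \<le> 2 ^ l'" using not_less_Least[of l' "\<lambda>l. 2 * d \<le> 2 ^ l"] l' by (simp add: l_def)
    then have lu: "2 ^ l < 4 * d" using l' by simp
    \<comment> \<open>The presence of an edge forces \<open>32 * d \<le> 2 ^ d\<close>, which leaves
      room for \<open>k \<ge> 1\<close>.\<close>
    have "2 ^ (l + 3) < 32 * d" using lu by (simp add: power_add)
    also have "\<dots> \<le> 2 ^ d" using m m1 by (metis dual_order.trans mult.right_neutral mult_le_mono2)
    finally have "l + 3 < d" by simp
    then obtain k where k: "d = k + 2 + l" "k \<ge> 1"
      using le_Suc_ex[of "l + 3" d] by (metis add.commute add.left_commute le_add1 less_imp_le numeral_3_eq_3 one_add_one plus_1_eq_Suc)
    have "8 * 2 ^ l * ?m \<le> 32 * d * ?m" using lu by simp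
    also have "\<dots> \<le> 2 ^ k * 4 * 2 ^ l" using m k by (simp add: power_add)
    finally have "2 * ?m \<le> 2 ^ k" by simp
    moreover have "2 * k \<le> 2 ^ l" using l k by simp
    ultimately show ?thesis using is_minor_hypercube[OF H(1,2)] k by simp
  qed
qed

theorem theoremA:
  shows "(\<exists>c>0::real. \<forall>d\<ge>1::nat. minor_universal (c * 2 ^ d / real d) (hypercube d)) \<and>
         (\<exists>C>0::real. \<forall>d\<ge>1::nat. \<not> minor_universal (C * 2 ^ d / sqrt (real d)) (hypercube d))"
proof
  show "\<exists>c>0::real. \<forall>d\<ge>1::nat. minor_universal (c * 2 ^ d / real d) (hypercube d)"
    using hypercube_universal by (intro exI[of _ "1 / 32"]) simp
  show "\<exists>C>0::real. \<forall>d\<ge>1::nat. \<not> minor_universal (C * 2 ^ d / sqrt (real d)) (hypercube d)"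
    using hypercube_not_universal by (intro exI[of _ 94]) simp
qed

end
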